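(* For every $w\in\tilde S_n$ ($n>2$), the affine Stanley symmetric function $\tilde F_w$ is a symmetric function.
   Context: $\tilde S_n$ is the affine symmetric group with generators $s_0,\ldots,s_{n-1}$ (indices mod $n$), relations $s_i^2=1$, $s_is_{i+1}s_i=s_{i+1}s_is_{i+1}$, $s_is_j=s_js_i$ for $i-j\not\equiv0,\pm1$; $\ell$ is the length function. A word in $\mathbb Z/n\mathbb Z$ is cyclically decreasing if each letter occurs at most once and whenever $i,i+1$ both occur, $i+1$ precedes $i$; an element is cyclically decreasing if it has a cyclically decreasing reduced word (the identity included). $\tilde F_w=\sum x_1^{\ell(v_1)}x_2^{\ell(v_2)}\cdots$, summed over infinite sequences $(v_1,v_2,\ldots)$ of cyclically decreasing elements, all but finitely many the identity, with $v_1v_2\cdots=w$ and $\sum\ell(v_i)=\ell(w)$. *)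

theory Defs
  imports Main
begin

text \<open>Elements of the affine symmetric group are represented by words in the letters
  0..n-1 (generator s_i is letter i), modulo the congruence generated by the Coxeter relations.\<close>

inductive aff_step :: "nat \<Rightarrow> nat list \<Rightarrow> nat list \<Rightarrow> bool" for n :: nat where
  square: "i < n \<Longrightarrow> aff_step n (u @ [i, i] @ v) (u @ v)"
| braid: "i < n \<Longrightarrow> aff_step n (u @ [i, (i+1) mod n, i] @ v) (u @ [(i+1) mod n, i, (i+1) mod n] @ v)"
| comm: "i < n \<Longrightarrow> j < n \<Longrightarrow> i \<noteq> j \<Longrightarrow> j \<noteq> (i+1) mod n \<Longrightarrow> i \<noteq> (j+1) mod n
          \<Longrightarrow> aff_step n (u @ [i, j] @ v) (u @ [j, i] @ v)"

definition aff_eq :: "nat \<Rightarrow> nat list \<Rightarrow> nat list \<Rightarrow> bool" where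
  "aff_eq n = (symclp (aff_step n))\<^sup>*\<^sup>*"

definition aff_class :: "nat \<Rightarrow> nat list \<Rightarrow> nat list set" where
  "aff_class n u = {u'. aff_eq n u u'}"

definition aff_len :: "nat \<Rightarrow> nat list \<Rightarrow> nat" where
  "aff_len n u = (LEAST k. \<exists>u'. aff_eq n u u' \<and> length u' = k)"

definition cyc_dec_word :: "nat \<Rightarrow> nat list \<Rightarrow> bool" where
  "cyc_dec_word n u \<longleftrightarrow> set u \<subseteq> {..<n} \<and> distinct u \<and>
     (\<forall>j k. j < k \<and> k < length u \<longrightarrow> u ! k \<noteq> (u ! j + 1) mod n)"

definition cd_elem :: "nat \<Rightarrow> nat list \<Rightarrow> bool" where
  "cd_elem n u \<longleftrightarrow> set u \<subseteq> {..<n} \<and>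
     (\<exists>u'. aff_eq n u u' \<and> cyc_dec_word n u' \<and> length u' = aff_len n u)"

text \<open>Coefficient of the monomial x_0^(a 0) x_1^(a 1) ... in the affine Stanley symmetric
  function of the element represented by w (variables indexed from 0): the number of sequences
  (V 0, V 1, ...) of cyclically decreasing elements with length (V i) = a i, all but finitely
  many the identity, product equal to w and total length equal to the length of w.\<close>
definition aff_stanley_coeff :: "nat \<Rightarrow> nat list \<Rightarrow> (nat \<Rightarrow> nat) \<Rightarrow> nat" where
  "aff_stanley_coeff n w a = card {V :: nat \<Rightarrow> nat list set. \<exists>us N.
      (\<forall>i. V i = aff_class n (us i) \<and> cd_elem n (us i) \<and> aff_len n (us i) = a i) \<and>
      (\<forall>i\<ge>N. a i = 0) \<and>
      aff_eq n (concat (map us [0..<N])) w \<and>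
      (\<Sum>i<N. a i) = aff_len n w}"

text \<open>A formal power series in x_0, x_1, ... (given by its coefficient function on exponent
  vectors) is a symmetric function: it is supported on finitely supported monomials of bounded
  degree and is invariant under every permutation of the variables.\<close>
definition symmetric_function :: "((nat \<Rightarrow> nat) \<Rightarrow> 'a::zero) \<Rightarrow> bool" where
  "symmetric_function c \<longleftrightarrow>
     (\<exists>d. \<forall>a. c a \<noteq> 0 \<longrightarrow> finite {i. a i \<noteq> 0} \<and> sum a {i. a i \<noteq> 0} \<le> d) \<and>
     (\<forall>a \<sigma>. bij \<sigma> \<longrightarrow> c (a \<circ> \<sigma>) = c a)"

end

theory Submission
  imports Defs "HOL-Number_Theory.Cong" "HOL-Library.Multiset"
begin

text \<open>A cyclically decreasing element is determined by its support, a proper subset of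
  \<open>\<int>/n\<close>, so it suffices to find, for reduced products of two such elements with supports
  \<open>(A, B)\<close>, an involution that preserves the product and exchanges \<open>|A|\<close> and \<open>|B|\<close>.

  Cut the circle after \<open>x\<close> unless \<open>x \<in> A\<close> and \<open>x + 1 \<in> B\<close>. Inside a block \<open>[a, b]\<close> between
  cuts, \<open>A\<close> contains \<open>[a, b)\<close> and \<open>B\<close> contains \<open>(a, b]\<close>; if moreover \<open>b \<in> A\<close> or \<open>a \<in> B\<close>,
  call the block occupied, of type A or type B. Both cannot happen in a reduced product, and two
  blocks of types A, B are never adjacent in this order. Because
  \<open>(s\<^sub>b \<cdots> s\<^sub>a)(s\<^sub>b \<cdots> s\<^sub>a\<^sub>+\<^sub>1) = (s\<^sub>b\<^sub>-\<^sub>1 \<cdots> s\<^sub>a)(s\<^sub>b \<cdots> s\<^sub>a)\<close>, changing the type of one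
  block does not change the product. Hence the product depends only on the cuts and on the
  set of occupied blocks, and a maximal run of occupied blocks has types B...BA...A.
  The involution reverses each run and exchanges the two types.\<close>

subsection \<open>The affine symmetric group\<close>

lemma aff_eq_equivclp: "aff_eq n = equivclp (aff_step n)"
  by (simp add: aff_eq_def equivclp_def)

lemma aff_eq_refl [simp, intro]: "aff_eq n u u"
  by (simp add: aff_eq_def)

lemma aff_eq_sym: "aff_eq n u v \<Longrightarrow> aff_eq n v u"
  by (simp add: aff_eq_equivclp equivclp_sym)

lemma aff_eq_trans [trans]: "aff_eq n u v \<Longrightarrow> aff_eq n v w \<Longrightarrow> aff_eq n u w"
  unfolding aff_eq_equivclp by (rule equivclp_trans)

lemma aff_eq_step: "aff_step n u v \<Longrightarrow> aff_eq n u v"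
  by (simp add: aff_eq_equivclp r_into_equivclp)

lemma aff_step_context:
  assumes "aff_step n u v"
  shows "aff_step n (p @ u @ q) (p @ v @ q)"
  using assms
proof cases
  case (square i u' v')
  then show ?thesis using aff_step.square[of i n "p @ u'" "v' @ q"] by simp
next
  case (braid i u' v')
  then show ?thesis using aff_step.braid[of i n "p @ u'" "v' @ q"] by simp
next
  case (comm i j u' v')
  then show ?thesis using aff_step.comm[of i n j "p @ u'" "v' @ q"] by simp
qed

lemma aff_eq_context:
  assumes "aff_eq n u v"
  shows "aff_eq n (p @ u @ q) (p @ v @ q)"
  using assms unfolding aff_eq_equivclp
proof (induction rule: equivclp_induct)
  case base
  then show ?case by simp
next
  case (step y z)
  then have "equivclp (aff_step n) (p @ y @ q) (p @ z @ q)"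
    by (auto intro: r_into_equivclp converse_r_into_equivclp aff_step_context)
  with step.IH show ?case by (rule equivclp_trans)
qed

lemma aff_eq_append:
  assumes "aff_eq n u u'" "aff_eq n v v'"
  shows "aff_eq n (u @ v) (u' @ v')"
  using aff_eq_context[OF assms(1), of "[]" v] aff_eq_context[OF assms(2), of u' "[]"]
  by (auto intro: aff_eq_trans)

lemma aff_eq_concat:
  assumes "\<And>i. i \<in> set is \<Longrightarrow> aff_eq n (f i) (g i)"
  shows "aff_eq n (concat (map f is)) (concat (map g is))"
  using assms by (induction "is") (auto intro: aff_eq_append)

lemma aff_eq_Cons: "aff_eq n u v \<Longrightarrow> aff_eq n (x # u) (x # v)"
  using aff_eq_append[of n "[x]" "[x]"] by simp

lemma aff_eq_commute_past:
  assumes "x < n" "\<And>y. y \<in> set v \<Longrightarrow> y < n \<and> y \<noteq> x \<and> y \<noteq> Suc x mod n \<and> x \<noteq> Suc y mod n"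
  shows "aff_eq n (v @ [x]) (x # v)"
  using assms(2)
proof (induction v)
  case Nil
  then show ?case by simp
next
  case (Cons y v)
  have "aff_eq n (y # v @ [x]) (y # x # v)"
    using Cons by (intro aff_eq_Cons) simp
  also have "aff_eq n (y # x # v) (x # y # v)"
    using aff_step.comm[of y n x "[]" v] assms(1) Cons.prems[of y] by (intro aff_eq_step) auto
  finally show ?case by simp
qed

lemma aff_class_eq_iff: "aff_class n u = aff_class n v \<longleftrightarrow> aff_eq n u v"
  unfolding aff_class_def by (auto intro: aff_eq_sym aff_eq_trans)

lemma aff_len_le: "aff_eq n u v \<Longrightarrow> aff_len n u \<le> length v"
  unfolding aff_len_def by (rule Least_le) blast

lemma aff_len_attained:
  obtains v where "aff_eq n u v" "length v = aff_len n u"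
  using LeastI_ex[of "\<lambda>k. \<exists>u'. aff_eq n u u' \<and> length u' = k"] unfolding aff_len_def by blast

lemma aff_len_cong:
  assumes "aff_eq n u v"
  shows "aff_len n u = aff_len n v"
  using assms aff_len_le aff_len_attained by (metis aff_eq_sym aff_eq_trans antisym)

section \<open>The reflection representation, which detects the letters of a word\<close>

definition cartan :: "nat \<Rightarrow> nat \<Rightarrow> nat \<Rightarrow> int" where
  "cartan n x j = (if x = j then 2 else if x = Suc j mod n \<or> j = Suc x mod n then -1 else 0)"

text \<open>The action of a simple reflection on coordinates with respect to the fundamental weights.\<close>
definition reflect :: "nat \<Rightarrow> nat \<Rightarrow> (nat \<Rightarrow> int) \<Rightarrow> nat \<Rightarrow> int" where
  "reflect n j c = (\<lambda>x. c x - c j * cartan n x j)"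

definition fund_weight :: "nat \<Rightarrow> nat \<Rightarrow> int" where
  "fund_weight i = (\<lambda>x. if x = i then 1 else 0)"

lemma reflect_reflect: "reflect n j (reflect n j c) = c"
  by (rule ext) (simp add: reflect_def cartan_def algebra_simps)

lemma reflect_braid:
  assumes "cartan n i j = -1" "cartan n j i = -1"
  shows "reflect n i (reflect n j (reflect n i c)) = reflect n j (reflect n i (reflect n j c))"
  using assms cartan_def[of n i i] cartan_def[of n j j]
  by (intro ext) (simp add: reflect_def algebra_simps)

lemma reflect_commute:
  assumes "cartan n i j = 0" "cartan n j i = 0"
  shows "reflect n i (reflect n j c) = reflect n j (reflect n i c)"
  using assms by (intro ext) (simp add: reflect_def algebra_simps)

text \<open>The reflections satisfy the three Coxeter relations, so a word acts through the element
  it represents. \<open>1 < n\<close> keeps neighbouring letters distinct, so that the entries used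
  in the braid case are -1.\<close>

lemma foldr_reflect_cong:
  assumes "1 < n" "aff_eq n u v"
  shows "foldr (reflect n) u c = foldr (reflect n) v c"
proof -
  have *: "foldr (reflect n) p c = foldr (reflect n) q c" if "aff_step n p q" for p q
    using that
  proof cases
    case (square i u v)
    then show ?thesis by (simp add: reflect_reflect)
  next
    case (braid i u v)
    have "Suc i mod n \<noteq> i"
      using \<open>1 < n\<close> \<open>i < n\<close> by (simp add: mod_Suc)
    then have "cartan n i (Suc i mod n) = -1" "cartan n (Suc i mod n) i = -1"
      by (auto simp: cartan_def)
    then show ?thesis using braid by (simp add: reflect_braid)
  next
    case (comm i j u v)
    then have "cartan n i j = 0" "cartan n j i = 0"
      by (auto simp: cartan_def)
    then show ?thesis using comm by (simp add: reflect_commute)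
  qed
  show ?thesis
    using assms(2) unfolding aff_eq_equivclp
    by (induction rule: equivclp_induct) (auto dest: *)
qed

lemma foldr_reflect_fund_weight_notin:
  "i \<notin> set u \<Longrightarrow> foldr (reflect n) u (fund_weight i) = fund_weight i"
  by (induction u) (auto simp: reflect_def fund_weight_def)

lemma inj_foldr_reflect: "inj (foldr (reflect n) u)"
proof (induction u)
  case Nil
  then show ?case by (simp add: inj_def)
next
  case (Cons j u)
  have "inj (reflect n j)"
    by (rule inj_on_inverseI[where g = "reflect n j"]) (rule reflect_reflect)
  then have "inj (reflect n j \<circ> foldr (reflect n) u)"
    using Cons by (rule inj_compose)
  then show ?case by (simp add: comp_def)
qed

text \<open>Only the letter \<open>i\<close> moves \<open>fund_weight i\<close>. If \<open>u\<close>
  consists of \<open>p\<close>, \<open>i\<close>, \<open>q\<close>, then \<open>q\<close> fixes the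
  weight, \<open>i\<close> moves it, and the injective action of \<open>p\<close>, which also fixes
  it, cannot move it back.\<close>

lemma foldr_reflect_fund_weight_in:
  assumes "distinct u" "i \<in> set u"
  shows "foldr (reflect n) u (fund_weight i) \<noteq> fund_weight i"
proof
  assume fixed: "foldr (reflect n) u (fund_weight i) = fund_weight i"
  from assms obtain p q where u: "u = p @ i # q" "i \<notin> set p" "i \<notin> set q"
    using split_list[of i u] by fastforce
  then have "foldr (reflect n) p (reflect n i (fund_weight i)) = foldr (reflect n) p (fund_weight i)"
    using fixed by (simp add: foldr_reflect_fund_weight_notin)
  then have "reflect n i (fund_weight i) = fund_weight i"
    using inj_foldr_reflect[of n p] by (simp add: inj_def)
  then have "reflect n i (fund_weight i) i = fund_weight i i"
    by simp
  then show False by (simp add: reflect_def fund_weight_def cartan_def)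
qed

text \<open>A letter \<open>i\<close> of \<open>u\<close> moves \<open>fund_weight i\<close>; so
  does the equivalent word \<open>v\<close>, which must then contain \<open>i\<close>. Hence
  equivalent words with distinct letters have the same support.\<close>

lemma set_subset_if_aff_eq_distinct:
  assumes "1 < n" "aff_eq n u v" "distinct u"
  shows "set u \<subseteq> set v"
proof
  fix i assume "i \<in> set u"
  then have "foldr (reflect n) v (fund_weight i) \<noteq> fund_weight i"
    using foldr_reflect_fund_weight_in[OF assms(3)] foldr_reflect_cong[OF assms(1,2)] by metis
  then show "i \<in> set v"
    using foldr_reflect_fund_weight_notin by blast
qed

text \<open>Every equivalent word contains all letters of \<open>u\<close>, so words without
  repeated letters are reduced, in particular the cyclically decreasing ones.\<close>

lemma aff_len_distinct:
  assumes "1 < n" "distinct u"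
  shows "aff_len n u = length u"
proof (rule antisym)
  show "aff_len n u \<le> length u"
    by (simp add: aff_len_le)
  obtain v where v: "aff_eq n u v" "length v = aff_len n u"
    by (rule aff_len_attained)
  have "length u = card (set u)"
    using assms by (simp add: distinct_card)
  also have "\<dots> \<le> card (set v)"
    using set_subset_if_aff_eq_distinct[OF assms(1) v(1) assms(2)] by (simp add: card_mono)
  also have "\<dots> \<le> aff_len n u"
    using card_length[of v] v by simp
  finally show "length u \<le> aff_len n u" .
qed

lemma cyc_dec_word_iff:
  "cyc_dec_word n u \<longleftrightarrow>
     set u \<subseteq> {..<n} \<and> distinct u \<and> sorted_wrt (\<lambda>x y. y \<noteq> Suc x mod n) u"
  unfolding cyc_dec_word_def sorted_wrt_iff_nth_less by auto

text \<open>The first letter \<open>x\<close> of \<open>u\<close> can be brought to the front of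
  \<open>v\<close>: a letter \<open>y\<close> before it in \<open>v\<close> comes after it in
  \<open>u\<close>, so the orders in \<open>v\<close> and \<open>u\<close> exclude
  \<open>x = y + 1\<close> and \<open>y = x + 1\<close>, respectively, and the two letters
  commute.\<close>

lemma cyc_dec_word_unique:
  assumes "cyc_dec_word n u" "cyc_dec_word n v" "set u = set v"
  shows "aff_eq n u v"
  using assms
proof (induction u arbitrary: v)
  case Nil
  then show ?case by simp
next
  case (Cons x u)
  then obtain p q where v: "v = p @ x # q"
    by (metis list.set_intros(1) split_list)
  have dist: "x \<notin> set u" "distinct v"
    using Cons.prems by (auto simp: cyc_dec_word_iff)
  have "aff_eq n u (p @ q)"
  proof (rule Cons.IH)
    show "cyc_dec_word n u" "cyc_dec_word n (p @ q)"
      using Cons.prems v by (auto simp: cyc_dec_word_iff sorted_wrt_append)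
    show "set u = set (p @ q)"
      using Cons.prems(3) dist by (auto simp: v)
  qed
  then have "aff_eq n (x # u) ((x # p) @ q)"
    by (simp add: aff_eq_Cons)
  also have "aff_eq n ((x # p) @ q) ((p @ [x]) @ q)"
  proof (intro aff_eq_append aff_eq_refl aff_eq_sym[OF aff_eq_commute_past])
    show "x < n"
      using Cons.prems by (auto simp: cyc_dec_word_iff)
  next
    fix y assume y: "y \<in> set p"
    then have "y \<noteq> x"
      using dist v by auto
    with y have "y \<in> set u"
      using Cons.prems(3) by (auto simp: v)
    with y \<open>y \<noteq> x\<close> show "y < n \<and> y \<noteq> x \<and> y \<noteq> Suc x mod n \<and> x \<noteq> Suc y mod n"
      using Cons.prems(1,2) v by (auto simp: cyc_dec_word_iff sorted_wrt_append)
  qed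
  finally show ?case by (simp add: v)
qed

lemma cyc_dec_word_append:
  "cyc_dec_word n (u @ v) \<longleftrightarrow> cyc_dec_word n u \<and> cyc_dec_word n v \<and> set u \<inter> set v = {} \<and>
     (\<forall>x\<in>set u. \<forall>y\<in>set v. y \<noteq> Suc x mod n)"
  by (auto simp: cyc_dec_word_iff sorted_wrt_append)

text \<open>Start and length, rather than two endpoints, let an interval wrap past
  \<open>n - 1\<close> without a separate case. The letters run from \<open>a + m - 1\<close> down
  to \<open>a\<close>.\<close>

definition desc_word :: "nat \<Rightarrow> nat \<Rightarrow> nat \<Rightarrow> nat list" where
  "desc_word n a m = map (\<lambda>j. (a + j) mod n) (rev [0..<m])"

lemma length_desc_word [simp]: "length (desc_word n a m) = m"
  by (simp add: desc_word_def)

lemma set_desc_word: "set (desc_word n a m) = (\<lambda>j. (a + j) mod n) ` {..<m}"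
  by (auto simp: desc_word_def)

lemma desc_word_0 [simp]: "desc_word n a 0 = []"
  by (simp add: desc_word_def)

lemma desc_word_Suc: "desc_word n a (Suc m) = (a + m) mod n # desc_word n a m"
  by (simp add: desc_word_def)

lemma desc_word_Suc': "desc_word n a (Suc m) = desc_word n (Suc a) m @ [a mod n]"
  by (induction m) (simp_all add: desc_word_Suc)

lemma add_mod_eq_iff:
  fixes a i j n :: nat
  assumes "i < n" "j < n"
  shows "(a + i) mod n = (a + j) mod n \<longleftrightarrow> i = j"
  using cong_add_lcancel_nat[of a i j n] assms by (simp add: cong_def)

subsection \<open>Cyclically decreasing words\<close>

text \<open>Because \<open>m < n\<close>, a gap remains on the circle: the successor of the top
  letter does not wrap around to the last letter \<open>a\<close>.\<close>

lemma cyc_dec_word_desc_word: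
  assumes "m < n"
  shows "cyc_dec_word n (desc_word n a m)"
proof -
  have "inj_on (\<lambda>j. (a + j) mod n) {..<m}"
    using assms by (auto simp: inj_on_def add_mod_eq_iff)
  moreover have "sorted_wrt (\<lambda>x y. (a + x) mod n \<noteq> Suc ((a + y) mod n) mod n) [0..<m]"
  proof -
    have "(a + i) mod n \<noteq> Suc ((a + j) mod n) mod n" if "i < j" "j < m" for i j
      using add_mod_eq_iff[of i n "Suc j" a] that assms by (simp add: mod_simps)
    then show ?thesis
      by (simp add: sorted_wrt_iff_nth_less)
  qed
  moreover have "set (desc_word n a m) \<subseteq> {..<n}"
    using assms by (auto simp: set_desc_word)
  ultimately show ?thesis
    by (simp add: cyc_dec_word_iff desc_word_def distinct_map sorted_wrt_map
        sorted_wrt_rev lessThan_atLeast0)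
qed

text \<open>If all letters occurred, the successor of the first letter would have to follow
  it.\<close>

lemma cyc_dec_word_set_psubset:
  assumes "1 < n" "cyc_dec_word n u"
  shows "set u \<subset> {..<n}"
proof -
  have "set u \<noteq> {..<n}"
  proof
    assume full: "set u = {..<n}"
    then obtain x v where u: "u = x # v"
      using assms(1) by (cases u) auto
    have "x < n"
      using full u by auto
    then have "Suc x mod n \<noteq> x"
      using assms(1) by (simp add: mod_Suc)
    moreover have "Suc x mod n \<in> set u"
      using full assms(1) by simp
    ultimately show False
      using assms(2) u by (auto simp: cyc_dec_word_iff)
  qed
  with assms(2) show ?thesis
    by (auto simp: cyc_dec_word_iff)
qed

text \<open>Cuts the circle at \<open>z\<close>: one interval runs through all other letters, so
  every set avoiding \<open>z\<close> can be ordered along it.\<close>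

lemma set_desc_word_pred:
  assumes "z < n"
  shows "set (desc_word n (Suc z) (n - 1)) = {..<n} - {z}"
proof (rule card_subset_eq)
  have "(Suc z + j) mod n \<noteq> z" if "j < n - 1" for j
    using add_mod_eq_iff[of j n "n - 1" "Suc z"] that assms by simp
  then show "set (desc_word n (Suc z) (n - 1)) \<subseteq> {..<n} - {z}"
    using assms by (auto simp: set_desc_word)
  have "distinct (desc_word n (Suc z) (n - 1))"
    using cyc_dec_word_desc_word[of "n - 1" n] assms by (simp add: cyc_dec_word_iff)
  then show "card (set (desc_word n (Suc z) (n - 1))) = card ({..<n} - {z})"
    using assms by (simp add: distinct_card)
qed simp

text \<open>Names the cyclically decreasing element with support \<open>A\<close>. All choices of
  the word are equivalent by \<open>cyc_dec_word_unique\<close>, and for a proper subset of the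
  letters one exists.\<close>

definition cyc_word :: "nat \<Rightarrow> nat set \<Rightarrow> nat list" where
  "cyc_word n A = (SOME u. cyc_dec_word n u \<and> set u = A)"

lemma cyc_word:
  assumes "A \<subset> {..<n}"
  shows "cyc_dec_word n (cyc_word n A)" "set (cyc_word n A) = A"
proof -
  obtain z where z: "z < n" "z \<notin> A"
    using assms by auto
  let ?u = "filter (\<lambda>x. x \<in> A) (desc_word n (Suc z) (n - 1))"
  have "cyc_dec_word n ?u"
    using cyc_dec_word_desc_word[of "n - 1" n "Suc z"] z
    by (auto simp: cyc_dec_word_iff intro: sorted_wrt_filter)
  moreover have "set ?u = A"
    using assms z unfolding set_filter set_desc_word_pred[OF z(1)] by blast
  ultimately have ex: "\<exists>u. cyc_dec_word n u \<and> set u = A"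
    by blast
  show "cyc_dec_word n (cyc_word n A)" "set (cyc_word n A) = A"
    using someI_ex[OF ex] unfolding cyc_word_def by simp_all
qed

lemma length_cyc_word: "A \<subset> {..<n} \<Longrightarrow> length (cyc_word n A) = card A"
  using cyc_word[of A n] distinct_card[of "cyc_word n A"] by (simp add: cyc_dec_word_iff)

lemma aff_len_cyc_word: "1 < n \<Longrightarrow> A \<subset> {..<n} \<Longrightarrow> aff_len n (cyc_word n A) = card A"
  using aff_len_distinct[of n "cyc_word n A"] cyc_word[of A n] length_cyc_word[of A n]
  by (simp add: cyc_dec_word_iff)

text \<open>Both words have distinct letters, so equivalence forces equal supports. Together with
  \<open>aff_eq_cyc_word\<close> this identifies cyclically decreasing elements with proper subsets
  of the letters.\<close>

lemma aff_eq_cyc_word_iff: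
  assumes "1 < n" "A \<subset> {..<n}" "B \<subset> {..<n}"
  shows "aff_eq n (cyc_word n A) (cyc_word n B) \<longleftrightarrow> A = B"
proof
  assume *: "aff_eq n (cyc_word n A) (cyc_word n B)"
  show "A = B"
    using set_subset_if_aff_eq_distinct[OF assms(1) *]
      set_subset_if_aff_eq_distinct[OF assms(1) aff_eq_sym[OF *]]
      cyc_word[OF assms(2)] cyc_word[OF assms(3)]
    by (auto simp: cyc_dec_word_iff)
qed simp

lemma aff_eq_cyc_word:
  assumes "cyc_dec_word n u" "1 < n"
  shows "aff_eq n (cyc_word n (set u)) u"
  using cyc_dec_word_unique[of n "cyc_word n (set u)" u] cyc_word[of "set u" n]
    cyc_dec_word_set_psubset[OF assms(2,1)] assms by simp

lemma aff_eq_cyc_word_append: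
  assumes "1 < n" "cyc_dec_word n u" "cyc_dec_word n v" "set u \<inter> set v = {}"
    "\<And>x y. x \<in> set u \<Longrightarrow> y \<in> set v \<Longrightarrow> y \<noteq> Suc x mod n"
  shows "aff_eq n (cyc_word n (set u \<union> set v)) (u @ v)"
  using aff_eq_cyc_word[of n "u @ v"] assms by (simp add: cyc_dec_word_append)

text \<open>A Coxeter element \<open>c\<close> of an interval satisfies \<open>c s\<^sub>j = s\<^sub>j\<^sub>-\<^sub>1 c\<close>.\<close>
lemma desc_word_slide:
  assumes "Suc m < n"
  shows "aff_eq n (desc_word n a (Suc m) @ desc_word n (Suc a) m)
           (desc_word n a m @ desc_word n a (Suc m))"
  using assms
proof (induction m)
  case 0
  then show ?case by simp
next
  case (Suc m)
  define z y where "z = (a + m) mod n" and "y = (a + Suc m) mod n"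
  have y: "y = (z + 1) mod n" "z < n" "y < n"
    using Suc.prems by (simp_all add: y_def z_def mod_simps)
  let ?d = "desc_word n a" and ?e = "desc_word n (Suc a)"
  \<comment> \<open>The letter \<open>y\<close> lies at least two above the letters of
    \<open>?d m\<close>, and the bound \<open>Suc (Suc m) < n\<close> prevents \<open>y + 1\<close>
    from wrapping around to \<open>a\<close>.\<close>
  have comm: "aff_eq n (?d m @ [y]) (y # ?d m)"
  proof (rule aff_eq_commute_past[OF \<open>y < n\<close>])
    fix x assume "x \<in> set (?d m)"
    then obtain j where j: "j < m" "x = (a + j) mod n"
      by (auto simp: set_desc_word)
    have Suc_mod: "Suc ((a + i) mod n) mod n = (a + Suc i) mod n" for i
      by (simp add: mod_Suc_eq)
    have "x \<noteq> y"
      unfolding j y_def using j Suc.prems by (subst add_mod_eq_iff) simp_all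
    moreover have "x \<noteq> Suc y mod n"
      unfolding j y_def Suc_mod using j Suc.prems by (subst add_mod_eq_iff) simp_all
    moreover have "y \<noteq> Suc x mod n"
      unfolding j y_def Suc_mod using j Suc.prems by (subst add_mod_eq_iff) simp_all
    ultimately show "x < n \<and> x \<noteq> y \<and> x \<noteq> Suc y mod n \<and> y \<noteq> Suc x mod n"
      using j Suc.prems by simp
  qed
  have "?d (Suc (Suc m)) @ ?e (Suc m) = [y, z] @ (?d m @ [y]) @ ?e m"
    by (simp add: desc_word_Suc y_def z_def)
  also have "aff_eq n \<dots> ([y, z] @ (y # ?d m) @ ?e m)"
    using comm by (intro aff_eq_append) simp_all
  also have "\<dots> = [y, z, y] @ (?d m @ ?e m)"
    by simp
  also have "aff_eq n \<dots> ([z, y, z] @ (?d m @ ?e m))"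
    using aff_step.braid[of z n "[]" "?d m @ ?e m"] y
    by (intro aff_eq_sym[OF aff_eq_step]) simp
  also have "\<dots> = [z, y] @ ?d (Suc m) @ ?e m"
    by (simp add: desc_word_Suc z_def)
  also have "aff_eq n \<dots> ([z, y] @ ?d m @ ?d (Suc m))"
    using aff_eq_append[OF aff_eq_refl Suc.IH[OF Suc_lessD[OF Suc.prems]]] .
  also have "\<dots> = [z] @ (y # ?d m) @ ?d (Suc m)"
    by simp
  also have "aff_eq n \<dots> ([z] @ (?d m @ [y]) @ ?d (Suc m))"
    using aff_eq_sym[OF comm] by (intro aff_eq_append) simp_all
  also have "\<dots> = ?d (Suc m) @ ?d (Suc (Suc m))"
    by (simp add: desc_word_Suc z_def y_def)
  finally show ?case .
qed

text \<open>Once the last letter \<open>a\<close> of the second factor is split off,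
  \<open>desc_word_slide\<close> applies. The word then ends in \<open>a a\<close>, and this square
  cancels.\<close>

lemma aff_len_desc_word_square:
  assumes "0 < m" "m < n"
  shows "aff_len n (desc_word n a m @ desc_word n a m) < 2 * m"
proof -
  obtain k where m: "m = Suc k"
    using assms(1) by (cases m) auto
  let ?d = "desc_word n a" and ?e = "desc_word n (Suc a)"
  have "?d m @ ?d m = (?d (Suc k) @ ?e k) @ [a mod n]"
    by (simp add: m desc_word_Suc')
  also have "aff_eq n \<dots> ((?d k @ ?d (Suc k)) @ [a mod n])"
    using assms by (intro aff_eq_append desc_word_slide) (simp_all add: m)
  also have "\<dots> = (?d k @ ?e k) @ [a mod n, a mod n] @ []"
    by (simp add: desc_word_Suc')
  also have "aff_eq n \<dots> ((?d k @ ?e k) @ [])"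
    using assms by (intro aff_eq_step aff_step.square) simp
  finally have "aff_len n (?d m @ ?d m) \<le> length ((?d k @ ?e k) @ [])"
    by (rule aff_len_le)
  then show ?thesis
    by (simp add: m)
qed

subsection \<open>Reversing runs on a cycle\<close>

text \<open>In a maximal run of \<open>Q\<close> along \<open>\<sigma>\<close> such a set is a final
  segment, possibly empty. It will record the blocks of type A, which come last in each run.\<close>

definition up_closed :: "('a \<Rightarrow> 'a) \<Rightarrow> 'a set \<Rightarrow> 'a set \<Rightarrow> bool" where
  "up_closed \<sigma> Q U \<longleftrightarrow> U \<subseteq> Q \<and> (\<forall>x\<in>U. \<sigma> x \<in> Q \<longrightarrow> \<sigma> x \<in> U)"

lemma funpow_cancel:
  fixes f g :: "'a \<Rightarrow> 'a"
  assumes "\<And>x. f (g x) = x"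
  shows "(f ^^ k) ((g ^^ k) x) = x"
proof (induction k)
  case (Suc k)
  have "(f ^^ Suc k) ((g ^^ Suc k) x) = (f ^^ k) (f (g ((g ^^ k) x)))"
    by (simp add: funpow_swap1)
  with Suc assms show ?case by simp
qed simp

text \<open>Since \<open>Q\<close> is left in both directions, every run consists of the images of
  some \<open>y\<close> under 1, ..., \<open>L - 1\<close> steps of \<open>\<sigma>\<close>, with
  the positions 0 and \<open>L\<close> outside \<open>Q\<close>. Then \<open>\<rho>\<close> sends
  position \<open>j\<close> to \<open>L - j\<close>; the last property says that it reverses the
  direction of \<open>\<sigma>\<close>.\<close>

lemma run_reversal:
  fixes \<sigma> \<tau> :: "'a \<Rightarrow> 'a"
  assumes inv: "\<And>x. \<sigma> (\<tau> x) = x" "\<And>x. \<tau> (\<sigma> x) = x"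
    and fwd: "\<And>x. x \<in> Q \<Longrightarrow> \<exists>j. (\<sigma> ^^ j) x \<notin> Q"
    and bwd: "\<And>x. x \<in> Q \<Longrightarrow> \<exists>j. (\<tau> ^^ j) x \<notin> Q"
  obtains \<rho> where "\<And>x. x \<in> Q \<Longrightarrow> \<rho> x \<in> Q" "\<And>x. x \<in> Q \<Longrightarrow> \<rho> (\<rho> x) = x"
    "\<And>x. x \<in> Q \<Longrightarrow> \<sigma> x \<in> Q \<Longrightarrow> \<sigma> (\<rho> (\<sigma> x)) = \<rho> x"
proof -
  define b where "b x = (LEAST j. (\<tau> ^^ j) x \<notin> Q)" for x
  define f where "f x = (LEAST j. (\<sigma> ^^ j) x \<notin> Q)" for x
  \<comment> \<open>Go back \<open>b x\<close> steps to the boundary before the run, then forward by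
    the distance \<open>f x\<close> from \<open>x\<close> to the boundary after it.\<close>
  define \<rho> where "\<rho> x = (\<sigma> ^^ f x) ((\<tau> ^^ b x) x)" for x
  define run where "run y L \<longleftrightarrow> y \<notin> Q \<and> (\<sigma> ^^ L) y \<notin> Q \<and> (\<forall>i. 0 < i \<longrightarrow> i < L \<longrightarrow> (\<sigma> ^^ i) y \<in> Q)" for y L
  have canc: "(\<sigma> ^^ k) ((\<tau> ^^ k) x) = x" and canc': "(\<tau> ^^ k) ((\<sigma> ^^ k) x) = x" for k x
    using funpow_cancel[of \<sigma> \<tau>] funpow_cancel[of \<tau> \<sigma>] inv by auto
  have in_run: "\<exists>y j L. x = (\<sigma> ^^ j) y \<and> 0 < j \<and> j < L \<and> run y L" if "x \<in> Q" for x
  proof (intro exI conjI)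
    have b: "(\<tau> ^^ b x) x \<notin> Q" "\<And>i. i < b x \<Longrightarrow> (\<tau> ^^ i) x \<in> Q"
      using LeastI_ex[OF bwd[OF that]] not_less_Least unfolding b_def by blast+
    have f: "(\<sigma> ^^ f x) x \<notin> Q" "\<And>i. i < f x \<Longrightarrow> (\<sigma> ^^ i) x \<in> Q"
      using LeastI_ex[OF fwd[OF that]] not_less_Least unfolding f_def by blast+
    show "x = (\<sigma> ^^ b x) ((\<tau> ^^ b x) x)"
      by (simp add: canc)
    show "0 < b x" "b x < b x + f x"
      using b(1) f(1) that by (auto intro: gr0I)
    have "(\<sigma> ^^ i) ((\<tau> ^^ b x) x) \<in> Q" if i: "0 < i" "i < b x + f x" for i
    proof (cases "i \<le> b x")
      case True
      then have "(\<tau> ^^ b x) x = (\<tau> ^^ i) ((\<tau> ^^ (b x - i)) x)"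
        by (simp flip: funpow_add[THEN fun_cong, simplified comp_apply])
      then show ?thesis
        using b(2)[of "b x - i"] i True by (simp add: canc)
    next
      case False
      then have "(\<sigma> ^^ i) ((\<tau> ^^ b x) x) = (\<sigma> ^^ (i - b x)) ((\<sigma> ^^ b x) ((\<tau> ^^ b x) x))"
        by (simp flip: funpow_add[THEN fun_cong, simplified comp_apply])
      then show ?thesis
        using f(2)[of "i - b x"] i False by (simp add: canc)
    qed
    moreover have "(\<sigma> ^^ (b x + f x)) ((\<tau> ^^ b x) x) \<notin> Q"
      using f(1) by (subst add.commute) (simp add: funpow_add canc)
    ultimately show "run ((\<tau> ^^ b x) x) (b x + f x)"
      using b(1) by (simp add: run_def)
  qed
  have \<rho>: "\<rho> ((\<sigma> ^^ j) y) = (\<sigma> ^^ (L - j)) y" if "run y L" "0 < j" "j < L" for y j L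
  proof -
    have "b ((\<sigma> ^^ j) y) = j" unfolding b_def
    proof (rule Least_equality)
      show "(\<tau> ^^ j) ((\<sigma> ^^ j) y) \<notin> Q"
        using that by (simp add: canc' run_def)
    next
      fix i assume i: "(\<tau> ^^ i) ((\<sigma> ^^ j) y) \<notin> Q"
      show "j \<le> i"
      proof (rule ccontr)
        assume "\<not> j \<le> i"
        then have "(\<sigma> ^^ j) y = (\<sigma> ^^ i) ((\<sigma> ^^ (j - i)) y)"
          by (simp flip: funpow_add[THEN fun_cong, simplified comp_apply])
        then have "(\<tau> ^^ i) ((\<sigma> ^^ j) y) = (\<sigma> ^^ (j - i)) y"
          by (simp add: canc')
        then show False
          using i that \<open>\<not> j \<le> i\<close> by (simp add: run_def)
      qed
    qed
    moreover have "f ((\<sigma> ^^ j) y) = L - j" unfolding f_def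
    proof (rule Least_equality)
      show "(\<sigma> ^^ (L - j)) ((\<sigma> ^^ j) y) \<notin> Q"
        using that by (simp add: run_def flip: funpow_add[THEN fun_cong, simplified comp_apply])
    next
      fix i assume i: "(\<sigma> ^^ i) ((\<sigma> ^^ j) y) \<notin> Q"
      show "L - j \<le> i"
      proof (rule ccontr)
        assume "\<not> L - j \<le> i"
        then have "(\<sigma> ^^ (i + j)) y \<in> Q"
          using that by (simp add: run_def)
        then show False
          using i by (simp add: funpow_add)
      qed
    qed
    ultimately show ?thesis
      by (simp add: \<rho>_def canc')
  qed
  show ?thesis
  proof
    fix x assume "x \<in> Q"
    then obtain y j L where x: "x = (\<sigma> ^^ j) y" and j: "0 < j" "j < L" and run: "run y L"
      using in_run by blast
    show "\<rho> x \<in> Q" "\<rho> (\<rho> x) = x"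
      using \<rho>[OF run j] \<rho>[OF run, of "L - j"] j run by (auto simp: x run_def)
    assume "\<sigma> x \<in> Q"
    then have "Suc j < L"
      using run j by (cases "Suc j = L") (auto simp: run_def x)
    then have "\<sigma> (\<rho> (\<sigma> x)) = (\<sigma> ^^ Suc (L - Suc j)) y"
      using \<rho>[OF run, of "Suc j"] by (simp add: x)
    then show "\<sigma> (\<rho> (\<sigma> x)) = \<rho> x"
      using \<rho>[OF run j] j by (simp add: x Suc_diff_Suc del: funpow.simps)
  qed
qed

text \<open>Let \<open>\<psi> U\<close> be the complement in \<open>Q\<close> of the image of
  \<open>U\<close> under the run reversal. Reversal turns final segments of runs into initial ones,
  and the complement makes them final again. One function serves all \<open>U\<close>.\<close>

lemma up_closed_reversal:
  fixes \<sigma> \<tau> :: "'a \<Rightarrow> 'a"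
  assumes inv: "\<And>x. \<sigma> (\<tau> x) = x" "\<And>x. \<tau> (\<sigma> x) = x"
    and fwd: "\<And>x. x \<in> Q \<Longrightarrow> \<exists>j. (\<sigma> ^^ j) x \<notin> Q"
    and bwd: "\<And>x. x \<in> Q \<Longrightarrow> \<exists>j. (\<tau> ^^ j) x \<notin> Q"
    and "finite Q"
  shows "\<exists>\<psi>. \<forall>U. up_closed \<sigma> Q U \<longrightarrow>
           up_closed \<sigma> Q (\<psi> U) \<and> \<psi> (\<psi> U) = U \<and> card (\<psi> U) = card (Q - U)"
proof -
  obtain \<rho> where \<rho>: "\<And>x. x \<in> Q \<Longrightarrow> \<rho> x \<in> Q" "\<And>x. x \<in> Q \<Longrightarrow> \<rho> (\<rho> x) = x"
    "\<And>x. x \<in> Q \<Longrightarrow> \<sigma> x \<in> Q \<Longrightarrow> \<sigma> (\<rho> (\<sigma> x)) = \<rho> x"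
    using run_reversal[OF inv fwd bwd] by metis
  have mem: "x \<in> \<rho> ` U \<longleftrightarrow> \<rho> x \<in> U" if "x \<in> Q" "U \<subseteq> Q" for x U
    using \<rho>(2) that by (metis image_iff subsetD)
  have "up_closed \<sigma> Q (Q - \<rho> ` U)" if U: "up_closed \<sigma> Q U" for U
    unfolding up_closed_def
  proof (intro conjI ballI impI)
    fix x assume x: "x \<in> Q - \<rho> ` U" "\<sigma> x \<in> Q"
    have "U \<subseteq> Q"
      using U by (simp add: up_closed_def)
    have "\<rho> (\<sigma> x) \<notin> U"
    proof
      assume "\<rho> (\<sigma> x) \<in> U"
      moreover have "\<sigma> (\<rho> (\<sigma> x)) = \<rho> x" "\<rho> x \<in> Q"
        using \<rho>(1,3) x by auto
      ultimately have "\<rho> x \<in> U"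
        using U by (auto simp: up_closed_def)
      then show False
        using x \<open>U \<subseteq> Q\<close> mem by blast
    qed
    then show "\<sigma> x \<in> Q - \<rho> ` U"
      using x \<open>U \<subseteq> Q\<close> mem by blast
  qed blast
  moreover have "Q - \<rho> ` (Q - \<rho> ` U) = U" if "U \<subseteq> Q" for U
    using mem[OF _ that] mem[of _ "Q - \<rho> ` U"] \<rho>(1,2) that by auto
  moreover have "card (Q - \<rho> ` U) = card (Q - U)" if "U \<subseteq> Q" for U
  proof -
    have "inj_on \<rho> U"
      using \<rho>(2) that by (metis inj_onI subsetD)
    moreover have "\<rho> ` U \<subseteq> Q"
      using \<rho>(1) that by auto
    ultimately show ?thesis
      using that \<open>finite Q\<close> by (simp add: card_Diff_subset finite_subset card_image)
  qed
  ultimately show ?thesis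
    by (intro exI[of _ "\<lambda>U. Q - \<rho> ` U"]) (auto simp: up_closed_def)
qed

section \<open>The cyclic successor within a set of letters\<close>

definition next_in :: "nat \<Rightarrow> nat set \<Rightarrow> nat \<Rightarrow> nat" where
  "next_in n S x =
     (if x \<in> S then (x + (LEAST j. 0 < j \<and> (x + j) mod n \<in> S)) mod n else x)"

lemma next_in:
  assumes "S \<subseteq> {..<n}" "x \<in> S"
  obtains m where "0 < m" "m \<le> n" "next_in n S x = (x + m) mod n" "(x + m) mod n \<in> S"
    "\<forall>j. 0 < j \<longrightarrow> j < m \<longrightarrow> (x + j) mod n \<notin> S"
proof -
  let ?P = "\<lambda>j. 0 < j \<and> (x + j) mod n \<in> S"
  \<comment> \<open>After \<open>n\<close> steps one is back at \<open>x\<close>, so the search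
    succeeds within one turn; for a singleton \<open>S\<close> the distance found is
    \<open>n\<close> itself.\<close>
  have n: "?P n"
    using assms by auto
  have "?P (Least ?P)"
    by (rule LeastI[of ?P, OF n])
  moreover have "Least ?P \<le> n"
    by (rule Least_le[of ?P, OF n])
  moreover have "\<not> ?P j" if "j < Least ?P" for j
    using not_less_Least[OF that] .
  ultimately show ?thesis
    using assms(2) by (intro that[of "Least ?P"]) (auto simp: next_in_def)
qed

lemma next_in_closed: "S \<subseteq> {..<n} \<Longrightarrow> x \<in> S \<Longrightarrow> next_in n S x \<in> S"
  by (erule (1) next_in) simp

text \<open>If steps from \<open>x\<close> and \<open>y\<close>, of lengths
  \<open>m \<le> m'\<close>, end at the same place, then \<open>x\<close> lies \<open>m' - m\<close>
  after \<open>y\<close>. Were this positive, the step from \<open>y\<close> would have stopped at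
  \<open>x\<close> or earlier.\<close>

lemma inj_on_next_in:
  assumes "S \<subseteq> {..<n}"
  shows "inj_on (next_in n S) S"
proof -
  have *: "x = y" if xy: "x \<in> S" "y \<in> S" "(x + m) mod n = (y + m') mod n" "m \<le> m'"
    "0 < m" and min: "\<forall>j. 0 < j \<longrightarrow> j < m' \<longrightarrow> (y + j) mod n \<notin> S" for x y m m'
  proof -
    have "[m + x = m + (y + (m' - m))] (mod n)"
      using xy by (simp add: cong_def ac_simps)
    then have "x mod n = (y + (m' - m)) mod n"
      using cong_add_lcancel_nat[of m x "y + (m' - m)" n] by (simp add: cong_def)
    then have x: "(y + (m' - m)) mod n = x"
      using xy assms by auto
    have "m' - m = 0"
    proof (rule ccontr)
      assume "m' - m \<noteq> 0"
      then show False
        using min[rule_format, of "m' - m"] x xy by simp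
    qed
    with x show ?thesis
      using xy assms by auto
  qed
  show ?thesis
  proof (rule inj_onI)
    fix x y assume xy: "x \<in> S" "y \<in> S" "next_in n S x = next_in n S y"
    obtain m where m: "0 < m" "m \<le> n" "next_in n S x = (x + m) mod n" "(x + m) mod n \<in> S"
      "\<forall>j. 0 < j \<longrightarrow> j < m \<longrightarrow> (x + j) mod n \<notin> S"
      by (rule next_in[OF assms xy(1)]) (rule that)
    obtain m' where m': "0 < m'" "m' \<le> n" "next_in n S y = (y + m') mod n" "(y + m') mod n \<in> S"
      "\<forall>j. 0 < j \<longrightarrow> j < m' \<longrightarrow> (y + j) mod n \<notin> S"
      by (rule next_in[OF assms xy(2)]) (rule that)
    show "x = y"
    proof (cases "m \<le> m'")
      case True
      show ?thesis
        by (rule *[OF xy(1,2) _ True m(1) m'(5)]) (use xy(3) in \<open>simp only: m(3) m'(3)\<close>)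
    next
      case False
      then have "m' \<le> m" by simp
      show ?thesis
        by (rule *[OF xy(2,1) _ \<open>m' \<le> m\<close> m'(1) m(5), symmetric])
          (use xy(3) in \<open>simp only: m(3) m'(3)\<close>)
    qed
  qed
qed

text \<open>On \<open>S\<close>, injectivity and finiteness suffice. Off \<open>S\<close> the
  function is the identity, which makes \<open>inv\<close> a genuine inverse everywhere.\<close>

lemma bij_next_in:
  assumes "S \<subseteq> {..<n}"
  shows "bij (next_in n S)"
proof -
  have "bij_betw (next_in n S) S S"
    using inj_on_next_in[OF assms] next_in_closed[OF assms] assms
    by (simp add: bij_betw_def endo_inj_surj finite_subset image_subsetI)
  moreover have "bij_betw (next_in n S) (- S) (- S)"
    using bij_betw_cong[of "- S" "next_in n S" id "- S"] by (simp add: next_in_def)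
  ultimately have "bij_betw (next_in n S) (S \<union> - S) (S \<union> - S)"
    by (rule bij_betw_combine) simp
  then show ?thesis by simp
qed

text \<open>By strong induction on the distance \<open>d\<close> to the target: one step never
  passes the target. So the successor map is a single cycle on \<open>S\<close>.\<close>

lemma next_in_transitive:
  assumes "S \<subseteq> {..<n}" "x \<in> S" "y \<in> S"
  obtains k where "(next_in n S ^^ k) x = y"
proof -
  have "\<exists>k. (next_in n S ^^ k) x = (x + d) mod n" if "x \<in> S" "(x + d) mod n \<in> S" for x d
    using that
  proof (induction d arbitrary: x rule: less_induct)
    case (less d)
    show ?case
    proof (cases "d = 0")
      case True
      then show ?thesis
        using less.prems assms by (intro exI[of _ 0]) auto
    next
      case False
      obtain m where m: "0 < m" "m \<le> n" "next_in n S x = (x + m) mod n" "(x + m) mod n \<in> S"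
      "\<forall>j. 0 < j \<longrightarrow> j < m \<longrightarrow> (x + j) mod n \<notin> S"
      by (rule next_in[OF assms(1) less.prems(1)]) (rule that)
      have "m \<le> d"
        using m(5)[rule_format, of d] less.prems(2) False by (cases "m \<le> d") simp_all
      then have eq: "((x + m) mod n + (d - m)) mod n = (x + d) mod n"
        using mod_add_left_eq[of "x + m" n "d - m"] by simp
      have "d - m < d"
        using m(1) False by simp
      from less.IH[OF this m(4), unfolded eq, OF less.prems(2)]
      obtain k where "(next_in n S ^^ k) ((x + m) mod n) = (x + d) mod n"
        by blast
      then have "(next_in n S ^^ Suc k) x = (x + d) mod n"
        using m(3) by (simp add: funpow_Suc_right del: funpow.simps)
      then show ?thesis by blast
    qed
  qed
  \<comment> \<open>\<open>n - x + y\<close> is a forward distance from \<open>x\<close> to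
    \<open>y\<close> in which the natural subtraction is not truncated.\<close>
  moreover have "x + (n - x + y) = n + y"
    using assms by auto
  then have "(x + (n - x + y)) mod n = y"
    using assms by auto
  ultimately obtain k where "(next_in n S ^^ k) x = y"
    using assms(2,3) by metis
  then show ?thesis by (rule that)
qed

subsection \<open>Products of two cyclically decreasing elements\<close>

text \<open>The interval can stand last if no \<open>x\<close> in \<open>A\<close> has its successor
  there. For the lowest letter this is assumed; for any other letter \<open>x\<close> itself would
  lie in the interval.\<close>

lemma aff_eq_cyc_word_Un_desc_word:
  assumes "1 < n" "m < n" "A \<subset> {..<n}" "A \<inter> set (desc_word n a m) = {}"
    "\<And>x. x \<in> A \<Longrightarrow> Suc x mod n \<noteq> a mod n"
  shows "aff_eq n (cyc_word n (A \<union> set (desc_word n a m))) (cyc_word n A @ desc_word n a m)"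
proof -
  have "y \<noteq> Suc x mod n" if x: "x \<in> A" and y: "y \<in> set (desc_word n a m)" for x y
  proof
    assume eq: "y = Suc x mod n"
    obtain j where j: "j < m" "y = (a + j) mod n"
      using y by (auto simp: set_desc_word)
    show False
    proof (cases j)
      case 0
      then show ?thesis using assms(5)[OF x] eq j by simp
    next
      case (Suc i)
      have "[Suc x = Suc (a + i)] (mod n)"
        using eq j Suc by (simp add: cong_def)
      then have "x mod n = (a + i) mod n"
        using cong_add_lcancel_nat[of 1 x "a + i" n] by (simp add: cong_def)
      then have "x = (a + i) mod n"
        using x assms(3) by auto
      then have "x \<in> set (desc_word n a m)"
        using j Suc by (auto simp: set_desc_word)
      then show ?thesis using x assms(4) by blast
    qed
  qed
  then show ?thesis
    using aff_eq_cyc_word_append[of n "cyc_word n A" "desc_word n a m"] assms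
    by (simp add: cyc_word cyc_dec_word_desc_word)
qed

text \<open>Mirror image: the interval can stand first because the letter just above it is not in
  \<open>B\<close>.\<close>

lemma aff_eq_cyc_word_desc_word_Un:
  assumes "1 < n" "m < n" "B \<subset> {..<n}" "B \<inter> set (desc_word n a m) = {}" "(a + m) mod n \<notin> B"
  shows "aff_eq n (cyc_word n (B \<union> set (desc_word n a m))) (desc_word n a m @ cyc_word n B)"
proof -
  have "y \<noteq> Suc x mod n" if x: "x \<in> set (desc_word n a m)" and y: "y \<in> B" for x y
  proof
    assume eq: "y = Suc x mod n"
    obtain j where j: "j < m" "x = (a + j) mod n"
      using x by (auto simp: set_desc_word)
    have "y = (a + Suc j) mod n"
      using eq j by (simp add: mod_Suc_eq)
    show False
    proof (cases "Suc j = m")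
      case True
      then show ?thesis using y assms(5) \<open>y = (a + Suc j) mod n\<close> by simp
    next
      case False
      then have "y \<in> set (desc_word n a m)"
        unfolding set_desc_word \<open>y = (a + Suc j) mod n\<close> using j(1) by (intro imageI) simp
      then show ?thesis using y assms(4) by blast
    qed
  qed
  then show ?thesis
    using aff_eq_cyc_word_append[of n "desc_word n a m" "cyc_word n B"] assms
    by (simp add: cyc_word cyc_dec_word_desc_word Un_commute Int_commute)
qed

text \<open>With the interval last in the left word and first in the right word, the two copies
  meet. By \<open>desc_word_slide\<close> the left copy then gives up its highest letter and the
  right one gains its lowest.\<close>

lemma aff_eq_cyc_word_flip:
  assumes "1 < n" "Suc k < n" "A \<subset> {..<n}" "B \<subset> {..<n}"
    "A \<inter> set (desc_word n a (Suc k)) = {}" "B \<inter> set (desc_word n a (Suc k)) = {}"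
    "\<And>x. x \<in> A \<Longrightarrow> Suc x mod n \<noteq> a mod n" "(a + Suc k) mod n \<notin> B"
  shows "aff_eq n
    (cyc_word n (A \<union> set (desc_word n a (Suc k))) @ cyc_word n (B \<union> set (desc_word n (Suc a) k)))
    (cyc_word n (A \<union> set (desc_word n a k)) @ cyc_word n (B \<union> set (desc_word n a (Suc k))))"
proof -
  let ?d = "desc_word n a" and ?e = "desc_word n (Suc a)"
  have sub: "set (?d k) \<subseteq> set (?d (Suc k))"
    by (auto simp: desc_word_Suc)
  have sub': "set (?e k) \<subseteq> set (?d (Suc k))"
    by (auto simp: desc_word_Suc')
  have "aff_eq n (cyc_word n (A \<union> set (?d (Suc k))) @ cyc_word n (B \<union> set (?e k)))
          ((cyc_word n A @ ?d (Suc k)) @ (?e k @ cyc_word n B))"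
    using assms sub sub'
    by (intro aff_eq_append aff_eq_cyc_word_Un_desc_word aff_eq_cyc_word_desc_word_Un) auto
  also have "\<dots> = cyc_word n A @ (?d (Suc k) @ ?e k) @ cyc_word n B"
    by simp
  also have "aff_eq n \<dots> (cyc_word n A @ (?d k @ ?d (Suc k)) @ cyc_word n B)"
    using assms by (intro aff_eq_context desc_word_slide)
  also have "\<dots> = (cyc_word n A @ ?d k) @ (?d (Suc k) @ cyc_word n B)"
    by simp
  also have "aff_eq n \<dots>
      (cyc_word n (A \<union> set (?d k)) @ cyc_word n (B \<union> set (?d (Suc k))))"
    using assms sub sub'
    by (intro aff_eq_append aff_eq_sym[OF aff_eq_cyc_word_Un_desc_word]
        aff_eq_sym[OF aff_eq_cyc_word_desc_word_Un]) auto
  finally show ?thesis .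
qed

text \<open>The two copies of the interval can be made to meet, and their square is not
  reduced.\<close>

lemma aff_len_cyc_word_common_interval:
  assumes "1 < n" "0 < m" "m < n" "A \<subset> {..<n}" "B \<subset> {..<n}"
    "A \<inter> set (desc_word n a m) = {}" "B \<inter> set (desc_word n a m) = {}"
    "\<And>x. x \<in> A \<Longrightarrow> Suc x mod n \<noteq> a mod n" "(a + m) mod n \<notin> B"
  shows "aff_len n (cyc_word n (A \<union> set (desc_word n a m)) @ cyc_word n (B \<union> set (desc_word n a m)))
    < card (A \<union> set (desc_word n a m)) + card (B \<union> set (desc_word n a m))"
proof -
  let ?d = "desc_word n a m"
  obtain v where v: "aff_eq n (?d @ ?d) v" "length v = aff_len n (?d @ ?d)"
    by (rule aff_len_attained)
  have fin: "finite A" "finite B"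
    using assms(4,5) by (auto intro: finite_subset)
  have card_d: "card (set ?d) = m"
    using cyc_dec_word_desc_word[OF assms(3)] distinct_card[of ?d] by (simp add: cyc_dec_word_iff)
  have "aff_eq n (cyc_word n (A \<union> set ?d) @ cyc_word n (B \<union> set ?d))
          ((cyc_word n A @ ?d) @ (?d @ cyc_word n B))"
    using assms
    by (intro aff_eq_append aff_eq_cyc_word_Un_desc_word aff_eq_cyc_word_desc_word_Un) auto
  also have "\<dots> = cyc_word n A @ (?d @ ?d) @ cyc_word n B"
    by simp
  also have "aff_eq n \<dots> (cyc_word n A @ v @ cyc_word n B)"
    using v(1) by (rule aff_eq_context)
  finally have "aff_len n (cyc_word n (A \<union> set ?d) @ cyc_word n (B \<union> set ?d))
      \<le> length (cyc_word n A @ v @ cyc_word n B)"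
    by (rule aff_len_le)
  also have "\<dots> < card A + 2 * m + card B"
    using aff_len_desc_word_square[of m n a] assms v(2) by (simp add: length_cyc_word)
  also have "\<dots> = card (A \<union> set ?d) + card (B \<union> set ?d)"
    using assms(6,7) card_d fin by (simp add: card_Un_disjoint)
  finally show ?thesis .
qed

text \<open>A pair \<open>(A, B)\<close> is cut at \<open>x\<close> unless \<open>x \<in> A\<close> and \<open>x + 1 \<in> B\<close>. A block lies between two
  consecutive cuts and is indexed by its last letter; it is occupied if its last letter is in \<open>A\<close> or its first letter is in \<open>B\<close>.
  Conversely, \<open>left_set\<close> and \<open>right_set\<close> rebuild \<open>(A, B)\<close> from the set \<open>S\<close> of cuts, the blocks \<open>U\<close>
  of type A and the blocks \<open>D\<close> of type B.\<close>

definition cuts :: "nat \<Rightarrow> nat set \<Rightarrow> nat set \<Rightarrow> nat set" where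
  "cuts n A B = {x. x < n \<and> \<not> (x \<in> A \<and> Suc x mod n \<in> B)}"

definition occupied :: "nat \<Rightarrow> nat set \<Rightarrow> nat set \<Rightarrow> nat set" where
  "occupied n A B = {e \<in> cuts n A B.
     e \<in> A \<or> Suc (inv (next_in n (cuts n A B)) e) mod n \<in> B}"

definition left_set :: "nat \<Rightarrow> nat set \<Rightarrow> nat set \<Rightarrow> nat set" where
  "left_set n S U = ({..<n} - S) \<union> U"

definition right_set :: "nat \<Rightarrow> nat set \<Rightarrow> nat set \<Rightarrow> nat set" where
  "right_set n S D = (\<lambda>x. Suc x mod n) ` (({..<n} - S) \<union> inv (next_in n S) ` D)"

lemma inj_on_Suc_mod: "inj_on (\<lambda>x. Suc x mod n) {..<n}"
  using add_mod_eq_iff[of _ n _ 1] by (auto simp: inj_on_def)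

lemma Suc_mod_image: "(\<lambda>x. Suc x mod n) ` {..<n} = {..<n}"
  by (intro endo_inj_surj inj_on_Suc_mod) auto

text \<open>\<open>S\<close> stands for the cuts and \<open>Q\<close> for the occupied blocks. That
  some block is unoccupied ends every run and keeps the rebuilt sets proper.\<close>

locale block_structure =
  fixes n :: nat and S Q :: "nat set"
  assumes n_gt: "1 < n" and S_subset: "S \<subseteq> {..<n}" and Q_psubset: "Q \<subset> S"
begin

abbreviation \<sigma> :: "nat \<Rightarrow> nat" where "\<sigma> \<equiv> next_in n S"
abbreviation \<tau> :: "nat \<Rightarrow> nat" where "\<tau> \<equiv> inv \<sigma>"

lemma \<sigma>_\<tau>: "\<sigma> (\<tau> x) = x"
  using bij_next_in[OF S_subset] by (simp add: bij_is_surj surj_f_inv_f)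

lemma \<tau>_\<sigma>: "\<tau> (\<sigma> x) = x"
  using bij_next_in[OF S_subset] by (simp add: bij_is_inj inv_f_f)

lemma \<sigma>_in_iff: "\<sigma> x \<in> S \<longleftrightarrow> x \<in> S"
proof (cases "x \<in> S")
  case True
  then show ?thesis by (simp add: next_in_closed S_subset)
next
  case False
  then show ?thesis by (simp add: next_in_def)
qed

lemma \<tau>_in_iff: "\<tau> x \<in> S \<longleftrightarrow> x \<in> S"
  using \<sigma>_in_iff[of "\<tau> x"] by (simp add: \<sigma>_\<tau>)

lemma exit_Q:
  assumes "x \<in> Q"
  shows "\<exists>j. (\<sigma> ^^ j) x \<notin> Q" "\<exists>j. (\<tau> ^^ j) x \<notin> Q"
proof -
  obtain z where z: "z \<in> S" "z \<notin> Q"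
    using Q_psubset by blast
  have "x \<in> S"
    using assms Q_psubset by blast
  obtain k where "(\<sigma> ^^ k) x = z"
    by (rule next_in_transitive[OF S_subset \<open>x \<in> S\<close> z(1)])
  then show "\<exists>j. (\<sigma> ^^ j) x \<notin> Q"
    using z by blast
  obtain l where "(\<sigma> ^^ l) z = x"
    by (rule next_in_transitive[OF S_subset z(1) \<open>x \<in> S\<close>])
  then have "(\<tau> ^^ l) x = z"
    using funpow_cancel[of \<tau> \<sigma> l z] \<tau>_\<sigma> by simp
  then show "\<exists>j. (\<tau> ^^ j) x \<notin> Q"
    using z by blast
qed

text \<open>Otherwise \<open>\<sigma>\<close> would preserve \<open>D\<close>, and an orbit would
  never leave \<open>Q\<close>. This supplies a type B block that is not followed by another
  one.\<close>

lemma exit_subset: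
  assumes "D \<subseteq> Q" "D \<noteq> {}"
  obtains e where "e \<in> D" "\<sigma> e \<notin> D"
proof (rule ccontr)
  assume "\<not> thesis"
  then have step: "\<sigma> e \<in> D" if "e \<in> D" for e
    using that \<open>\<And>e. e \<in> D \<Longrightarrow> \<sigma> e \<notin> D \<Longrightarrow> thesis\<close> by blast
  obtain x where "x \<in> D"
    using assms by blast
  then have "(\<sigma> ^^ j) x \<in> D" for j
    by (induction j) (auto intro: step)
  then show False
    using exit_Q(1)[of x] \<open>x \<in> D\<close> assms(1) by blast
qed

lemma finite_Q: "finite Q" "finite S"
  using S_subset Q_psubset finite_subset[of S "{..<n}"] finite_subset[of Q S] by auto

lemma in_left_set_iff:
  assumes "U \<subseteq> Q" "x < n"
  shows "x \<in> left_set n S U \<longleftrightarrow> x \<notin> S \<or> x \<in> U"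
  using assms by (simp add: left_set_def)

text \<open>The block starting just after a cut \<open>x\<close> is indexed by
  \<open>\<sigma> x\<close>; its first letter belongs to the right set exactly if the block has type
  B.\<close>

lemma Suc_in_right_set_iff:
  assumes "D \<subseteq> Q" "x < n"
  shows "Suc x mod n \<in> right_set n S D \<longleftrightarrow> x \<notin> S \<or> \<sigma> x \<in> D"
proof -
  have "({..<n} - S) \<union> \<tau> ` D \<subseteq> {..<n}"
    using assms(1) Q_psubset S_subset \<tau>_in_iff by fastforce
  then have "Suc x mod n \<in> right_set n S D \<longleftrightarrow> x \<in> ({..<n} - S) \<union> \<tau> ` D"
    unfolding right_set_def using assms(2) by (intro inj_on_image_mem_iff[OF inj_on_Suc_mod]) auto
  moreover have "x \<in> \<tau> ` D \<longleftrightarrow> \<sigma> x \<in> D"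
    by (auto simp: \<sigma>_\<tau> \<tau>_\<sigma> intro: image_eqI[of _ _ "\<sigma> x"])
  ultimately show ?thesis
    using assms(2) by blast
qed

lemma left_set_psubset:
  assumes "U \<subseteq> Q"
  shows "left_set n S U \<subset> {..<n}"
  using assms S_subset Q_psubset unfolding left_set_def by blast

lemma right_set_psubset:
  assumes "D \<subseteq> Q"
  shows "right_set n S D \<subset> {..<n}"
proof -
  obtain z where z: "z \<in> S" "z \<notin> D"
    using Q_psubset assms by blast
  have "\<tau> z \<in> S" "\<tau> z < n"
    using z \<tau>_in_iff S_subset by auto
  then have "Suc (\<tau> z) mod n \<notin> right_set n S D"
    using Suc_in_right_set_iff[OF assms, of "\<tau> z"] z by (simp add: \<sigma>_\<tau>)
  moreover have "Suc (\<tau> z) mod n < n"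
    using n_gt by simp
  moreover have "right_set n S D \<subseteq> {..<n}"
    using n_gt by (auto simp: right_set_def)
  ultimately show ?thesis
    by blast
qed

lemma card_left_set:
  assumes "U \<subseteq> Q"
  shows "card (left_set n S U) = card ({..<n} - S) + card U"
  unfolding left_set_def using assms finite_Q Q_psubset
  by (intro card_Un_disjoint) (auto intro: finite_subset)

lemma card_right_set:
  assumes "D \<subseteq> Q"
  shows "card (right_set n S D) = card ({..<n} - S) + card D"
proof -
  have D: "\<tau> ` D \<subseteq> S"
    using assms Q_psubset \<tau>_in_iff by auto
  have "inj_on (\<lambda>x. Suc x mod n) (({..<n} - S) \<union> \<tau> ` D)"
    using D S_subset by (intro inj_on_subset[OF inj_on_Suc_mod]) auto
  then have "card (right_set n S D) = card (({..<n} - S) \<union> \<tau> ` D)"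
    unfolding right_set_def by (rule card_image)
  also have "\<dots> = card ({..<n} - S) + card (\<tau> ` D)"
    using D finite_Q by (intro card_Un_disjoint) (auto intro: finite_subset)
  also have "inj_on \<tau> D"
    using \<sigma>_\<tau> by (rule inj_on_inverseI)
  then have "card (\<tau> ` D) = card D"
    by (rule card_image)
  finally show ?thesis .
qed

text \<open>A cut would be lost only between a type A block and a type B block following it, which
  \<open>up_closed\<close> excludes.\<close>

lemma cuts_eq:
  assumes U: "up_closed \<sigma> Q U"
  shows "cuts n (left_set n S U) (right_set n S (Q - U)) = S"
proof -
  have "U \<subseteq> Q"
    using U by (simp add: up_closed_def)
  have "x \<in> left_set n S U \<and> Suc x mod n \<in> right_set n S (Q - U) \<longleftrightarrow> x \<notin> S" if "x < n" for x
    using in_left_set_iff[OF \<open>U \<subseteq> Q\<close> that] Suc_in_right_set_iff[OF Diff_subset that] U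
    unfolding up_closed_def by blast
  then show ?thesis
    using S_subset unfolding cuts_def by blast
qed

lemma left_set_Int_cuts: "U \<subseteq> Q \<Longrightarrow> left_set n S U \<inter> S = U"
  using Q_psubset by (auto simp: left_set_def)

lemma occupied_eq:
  assumes U: "up_closed \<sigma> Q U"
  shows "occupied n (left_set n S U) (right_set n S (Q - U)) = Q"
proof -
  have "U \<subseteq> Q"
    using U by (simp add: up_closed_def)
  have "e \<in> left_set n S U \<or> Suc (\<tau> e) mod n \<in> right_set n S (Q - U) \<longleftrightarrow> e \<in> Q" if "e \<in> S" for e
  proof -
    have "\<tau> e < n" "e < n" "\<tau> e \<in> S"
      using that S_subset \<tau>_in_iff by auto
    then show ?thesis
      using in_left_set_iff[OF \<open>U \<subseteq> Q\<close>, of e] Suc_in_right_set_iff[OF Diff_subset, of "\<tau> e"]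
        that \<open>U \<subseteq> Q\<close> by (auto simp: \<sigma>_\<tau>)
  qed
  then show ?thesis
    using Q_psubset unfolding occupied_def cuts_eq[OF U] by blast
qed

text \<open>\<open>aff_eq_cyc_word_flip\<close>, read backwards on the letters of the block, turns
  type B into type A. The next block, if occupied, already has type A, so the new set is still
  closed.\<close>

lemma aff_eq_flip_block:
  assumes U: "up_closed \<sigma> Q U" and e: "e \<in> Q - U" "\<sigma> e \<notin> Q - U"
  shows "up_closed \<sigma> Q (insert e U)"
    "aff_eq n (cyc_word n (left_set n S U) @ cyc_word n (right_set n S (Q - U)))
      (cyc_word n (left_set n S (insert e U)) @ cyc_word n (right_set n S (Q - insert e U)))"
proof -
  have "U \<subseteq> Q" "e \<in> S"
    using U e Q_psubset by (auto simp: up_closed_def)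
  then have U': "insert e U \<subseteq> Q"
    using e by blast
  show "up_closed \<sigma> Q (insert e U)"
    using U e by (auto simp: up_closed_def)
  \<comment> \<open>\<open>x\<close> is the cut before the block, whose letters are
    \<open>x + 1\<close> up to \<open>x + m\<close>, which is \<open>e\<close>.\<close>
  define x where "x = \<tau> e"
  have x: "x \<in> S" "x < n" "\<sigma> x = e" "e < n"
    using \<open>e \<in> S\<close> S_subset \<tau>_in_iff \<sigma>_\<tau> by (auto simp: x_def)
  \<comment> \<open>Otherwise \<open>e\<close> would be its own successor, against
    \<open>\<sigma> e \<notin> Q - U\<close>. Hence the block is not the whole circle.\<close>
  have "x \<noteq> e"
    using x(3) e by auto
  have "x \<notin> U"
    using U e x(3) by (auto simp: up_closed_def)
  obtain m where m: "0 < m" "m \<le> n" "\<sigma> x = (x + m) mod n" "(x + m) mod n \<in> S"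
      "\<forall>j. 0 < j \<longrightarrow> j < m \<longrightarrow> (x + j) mod n \<notin> S"
    by (rule next_in[OF S_subset x(1)]) (rule that)
  then obtain k where k: "m = Suc k"
    by (cases m) auto
  have "m \<noteq> n"
    using m(3) x \<open>x \<noteq> e\<close> by auto
  then have "Suc k < n"
    using m(2) k by simp
  let ?I = "set (desc_word n (Suc x) (Suc k))"
  have e_eq: "e = (Suc x + k) mod n"
    using m(3) x(3) k by simp
  have I_low: "set (desc_word n (Suc x) k) = ?I - {e}"
    "e \<in> ?I" "set (desc_word n (Suc x) k) \<inter> S = {}"
  proof -
    show "e \<in> ?I"
      by (simp add: desc_word_Suc e_eq)
    have "e \<notin> set (desc_word n (Suc x) k)"
      using cyc_dec_word_desc_word[OF \<open>Suc k < n\<close>, of "Suc x"]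
      by (simp add: cyc_dec_word_iff desc_word_Suc e_eq)
    then show "set (desc_word n (Suc x) k) = ?I - {e}"
      by (auto simp: desc_word_Suc e_eq)
    have "(Suc x + j) mod n \<notin> S" if "j < k" for j
      using m(5)[rule_format, of "Suc j"] that k by simp
    then show "set (desc_word n (Suc x) k) \<inter> S = {}"
      by (auto simp: set_desc_word)
  qed
  have I_high: "set (desc_word n (Suc (Suc x)) k) = ?I - {Suc x mod n}" "Suc x mod n \<in> ?I"
  proof -
    show "Suc x mod n \<in> ?I"
      by (simp add: desc_word_Suc')
    have "Suc x mod n \<notin> set (desc_word n (Suc (Suc x)) k)"
      using cyc_dec_word_desc_word[OF \<open>Suc k < n\<close>, of "Suc x"]
      by (simp add: cyc_dec_word_iff desc_word_Suc')
    then show "set (desc_word n (Suc (Suc x)) k) = ?I - {Suc x mod n}"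
      by (auto simp: desc_word_Suc')
  qed
  have I_lt: "?I \<subseteq> {..<n}"
    using n_gt by (auto simp: set_desc_word)
  have I_left: "?I \<subseteq> left_set n S (insert e U)"
    using I_low I_lt by (auto simp: left_set_def)
  have e_notin: "e \<notin> left_set n S U"
    using e \<open>e \<in> S\<close> by (simp add: left_set_def)
  have Suc_I: "y \<in> set (desc_word n (Suc (Suc x)) k) \<Longrightarrow>
      \<exists>z. z < n \<and> z \<notin> S \<and> y = Suc z mod n" for y
  proof -
    assume "y \<in> set (desc_word n (Suc (Suc x)) k)"
    then obtain j where j: "j < k" "y = (Suc (Suc x) + j) mod n"
      by (auto simp: set_desc_word)
    then have "y = Suc ((x + Suc j) mod n) mod n"
      by (simp add: mod_Suc_eq)
    moreover have "(x + Suc j) mod n \<notin> S"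
      using m(5)[rule_format, of "Suc j"] j k by simp
    moreover have "(x + Suc j) mod n < n"
      using n_gt by simp
    ultimately show ?thesis by blast
  qed
  have right_shape: "right_set n S (Q - U) = insert (Suc x mod n) (right_set n S (Q - insert e U))"
  proof -
    have "Q - U = insert e (Q - insert e U)"
      using e by blast
    then show ?thesis
      by (simp add: right_set_def x_def)
  qed
  have x_notin: "Suc x mod n \<notin> right_set n S (Q - insert e U)"
    using Suc_in_right_set_iff[OF Diff_subset x(2)] x by simp
  have I_right: "?I \<subseteq> right_set n S (Q - U)"
  proof -
    have "y \<in> right_set n S (Q - U)" if "y \<in> ?I" for y
    proof (cases "y = Suc x mod n")
      case True
      then show ?thesis by (simp add: right_shape)
    next
      case False
      then have "y \<in> set (desc_word n (Suc (Suc x)) k)"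
        using that I_high by blast
      then show ?thesis
        using Suc_I[of y] Suc_in_right_set_iff[OF Diff_subset] by auto
    qed
    then show ?thesis by blast
  qed
  \<comment> \<open>Outside the block the two pairs agree; \<open>A\<close> and \<open>B\<close> are
    these common parts.\<close>
  define A where "A = left_set n S (insert e U) - ?I"
  define B where "B = right_set n S (Q - U) - ?I"
  have eqs: "left_set n S (insert e U) = A \<union> set (desc_word n (Suc x) (Suc k))"
    "left_set n S U = A \<union> set (desc_word n (Suc x) k)"
    "right_set n S (Q - U) = B \<union> set (desc_word n (Suc x) (Suc k))"
    "right_set n S (Q - insert e U) = B \<union> set (desc_word n (Suc (Suc x)) k)"
  proof -
    show "left_set n S (insert e U) = A \<union> ?I" "right_set n S (Q - U) = B \<union> ?I"
      using I_left I_right unfolding A_def B_def by blast+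
    have left_less: "left_set n S U = left_set n S (insert e U) - {e}"
      using e_notin by (auto simp: left_set_def)
    show "left_set n S U = A \<union> set (desc_word n (Suc x) k)"
      using I_left I_low(2) unfolding A_def I_low(1) left_less by blast
    have right_less: "right_set n S (Q - insert e U) = right_set n S (Q - U) - {Suc x mod n}"
      using x_notin unfolding right_shape by blast
    show "right_set n S (Q - insert e U) = B \<union> set (desc_word n (Suc (Suc x)) k)"
      using I_right I_high(2) unfolding B_def I_high(1) right_less by blast
  qed
  have "aff_eq n
    (cyc_word n (A \<union> set (desc_word n (Suc x) (Suc k))) @ cyc_word n (B \<union> set (desc_word n (Suc (Suc x)) k)))
    (cyc_word n (A \<union> set (desc_word n (Suc x) k)) @ cyc_word n (B \<union> set (desc_word n (Suc x) (Suc k))))"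
  proof (rule aff_eq_cyc_word_flip[OF n_gt \<open>Suc k < n\<close>])
    show "A \<subset> {..<n}" "B \<subset> {..<n}"
      using left_set_psubset[OF U'] right_set_psubset[OF Diff_subset, of U]
      by (auto simp: A_def B_def)
    show "A \<inter> ?I = {}" "B \<inter> ?I = {}"
      by (auto simp: A_def B_def)
    \<comment> \<open>The boundary conditions of the flip hold because the preceding block is not of
      type A and the following one is not of type B.\<close>
    have "x \<notin> left_set n S (insert e U)"
      using x \<open>x \<noteq> e\<close> \<open>x \<notin> U\<close> by (simp add: left_set_def)
    then show "Suc y mod n \<noteq> Suc x mod n" if "y \<in> A" for y
      using that left_set_psubset[OF U'] x(2) inj_onD[OF inj_on_Suc_mod[of n], of y x]
      unfolding A_def by auto
    have "Suc e mod n \<notin> right_set n S (Q - U)"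
      using Suc_in_right_set_iff[OF Diff_subset x(4)] e \<open>e \<in> S\<close> by simp
    moreover have "(Suc x + Suc k) mod n = Suc e mod n"
      by (simp add: e_eq mod_Suc_eq)
    ultimately show "(Suc x + Suc k) mod n \<notin> B"
      by (simp add: B_def)
  qed
  then show "aff_eq n (cyc_word n (left_set n S U) @ cyc_word n (right_set n S (Q - U)))
      (cyc_word n (left_set n S (insert e U)) @ cyc_word n (right_set n S (Q - insert e U)))"
    unfolding eqs by (rule aff_eq_sym)
qed

text \<open>Type B blocks are flipped one by one, always one not followed by another type B block.
  The pair reached at the end depends on \<open>S\<close> and \<open>Q\<close> only.\<close>

lemma aff_eq_saturate:
  assumes "up_closed \<sigma> Q U"
  shows "aff_eq n (cyc_word n (left_set n S U) @ cyc_word n (right_set n S (Q - U)))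
    (cyc_word n (left_set n S Q) @ cyc_word n (right_set n S {}))"
  using assms
proof (induction "card (Q - U)" arbitrary: U rule: less_induct)
  case less
  show ?case
  proof (cases "Q - U = {}")
    case True
    then have "U = Q"
      using less.prems by (auto simp: up_closed_def)
    then show ?thesis by simp
  next
    case False
    then obtain e where e: "e \<in> Q - U" "\<sigma> e \<notin> Q - U"
      using exit_subset[of "Q - U"] by blast
    have "card (Q - insert e U) < card (Q - U)"
      using e finite_Q by (intro psubset_card_mono) auto
    with less.hyps aff_eq_flip_block[OF less.prems e] show ?thesis
      by (blast intro: aff_eq_trans)
  qed
qed

end

section \<open>Reduced pairs and the involution exchanging their sizes\<close>

definition reduced_pair :: "nat \<Rightarrow> nat set \<Rightarrow> nat set \<Rightarrow> bool" where
  "reduced_pair n A B \<longleftrightarrow> A \<subset> {..<n} \<and> B \<subset> {..<n} \<and>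
     aff_len n (cyc_word n A @ cyc_word n B) = card A + card B"

text \<open>If the block had both types, \<open>A\<close> and \<open>B\<close> would both contain
  all its letters. As its two ends are cuts, the letter before it is not in \<open>A\<close> and the
  letter after it is not in \<open>B\<close>, so \<open>aff_len_cyc_word_common_interval\<close>
  contradicts reducedness.\<close>

lemma reduced_pair_block:
  assumes "1 < n" and red: "reduced_pair n A B" and e: "e \<in> cuts n A B" "e \<in> A"
  shows "Suc (inv (next_in n (cuts n A B)) e) mod n \<notin> B"
proof
  define S where "S = cuts n A B"
  define x where "x = inv (next_in n S) e"
  assume "Suc (inv (next_in n (cuts n A B)) e) mod n \<in> B"
  then have Sx: "Suc x mod n \<in> B"
    by (simp add: x_def S_def)
  have S: "S \<subseteq> {..<n}"
    by (auto simp: S_def cuts_def)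
  have nx: "next_in n S x = e"
    using bij_next_in[OF S] by (simp add: x_def bij_is_surj surj_f_inv_f)
  have "e \<in> S"
    using e by (simp add: S_def)
  have "x \<in> S"
  proof (rule ccontr)
    assume "x \<notin> S"
    then have "next_in n S x = x"
      by (simp add: next_in_def)
    then show False
      using nx \<open>e \<in> S\<close> \<open>x \<notin> S\<close> by simp
  qed
  then have "x < n" "x \<notin> A"
    using Sx by (auto simp: S_def cuts_def)
  have AB: "A \<subset> {..<n}" "B \<subset> {..<n}"
    using red by (auto simp: reduced_pair_def)
  have inner: "y \<in> A" "Suc y mod n \<in> B" if "y < n" "y \<notin> S" for y
    using that by (auto simp: S_def cuts_def)
  obtain m where m: "0 < m" "m \<le> n" "next_in n S x = (x + m) mod n" "(x + m) mod n \<in> S"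
      "\<forall>j. 0 < j \<longrightarrow> j < m \<longrightarrow> (x + j) mod n \<notin> S"
    by (rule next_in[OF S \<open>x \<in> S\<close>]) (rule that)
  have em: "(x + m) mod n = e"
    using m(3) nx by simp
  \<comment> \<open>A full turn would give \<open>e = x\<close>, but \<open>e\<close> lies in
    \<open>A\<close> and \<open>x\<close> does not.\<close>
  have "m \<noteq> n"
    using em \<open>x < n\<close> \<open>x \<notin> A\<close> e by auto
  then have "m < n"
    using m(2) by simp
  let ?I = "set (desc_word n (Suc x) m)"
  have I_A: "?I \<subseteq> A"
  proof -
    have "(Suc x + j) mod n \<in> A" if "j < m" for j
    proof (cases "Suc j = m")
      case True
      then have "Suc x + j = x + m"
        by simp
      then show ?thesis
        using e(2) em by (simp only:)
    next
      case False
      then show ?thesis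
        using m(5)[rule_format, of "Suc j"] that inner(1)[of "(x + Suc j) mod n"] \<open>1 < n\<close> by simp
    qed
    then show ?thesis
      by (auto simp: set_desc_word)
  qed
  have I_B: "?I \<subseteq> B"
  proof -
    have "(Suc x + j) mod n \<in> B" if "j < m" for j
    proof (cases j)
      case 0
      then show ?thesis
        using Sx by simp
    next
      case (Suc i)
      then have "Suc ((x + j) mod n) mod n \<in> B"
        using m(5)[rule_format, of j] that inner(2)[of "(x + j) mod n"] \<open>1 < n\<close> by simp
      then show ?thesis
        by (simp add: mod_Suc_eq)
    qed
    then show ?thesis
      by (auto simp: set_desc_word)
  qed
  define A' B' where "A' = A - ?I" and "B' = B - ?I"
  have A'B': "A = A' \<union> ?I" "B = B' \<union> ?I"
    using I_A I_B unfolding A'_def B'_def by blast+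
  have "aff_len n (cyc_word n (A' \<union> ?I) @ cyc_word n (B' \<union> ?I)) < card (A' \<union> ?I) + card (B' \<union> ?I)"
  proof (rule aff_len_cyc_word_common_interval[OF \<open>1 < n\<close> m(1) \<open>m < n\<close>])
    show "A' \<subset> {..<n}" "B' \<subset> {..<n}" "A' \<inter> ?I = {}" "B' \<inter> ?I = {}"
      using AB unfolding A'_def B'_def by blast+
    show "Suc y mod n \<noteq> Suc x mod n" if "y \<in> A'" for y
    proof
      assume "Suc y mod n = Suc x mod n"
      moreover have "y \<in> {..<n}"
        using that AB unfolding A'_def by blast
      ultimately have "y = x"
        using inj_onD[OF inj_on_Suc_mod[of n], of y x] \<open>x < n\<close> by simp
      then show False
        using that \<open>x \<notin> A\<close> by (simp add: A'_def)
    qed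
    have "Suc e mod n \<notin> B"
      using e by (auto simp: cuts_def)
    moreover have "Suc e mod n = (Suc x + m) mod n"
      using mod_Suc_eq[of "x + m" n] em by simp
    ultimately show "(Suc x + m) mod n \<notin> B'"
      by (simp add: B'_def)
  qed
  then show False
    using red unfolding reduced_pair_def A'B'[symmetric] by simp
qed

text \<open>After a type A block ending at the cut \<open>e\<close>, the letter \<open>e + 1\<close>
  is not in \<open>B\<close>, so the next block, if occupied, also has type A. No block has both
  types, so the occupied blocks outside \<open>A \<inter> S\<close> are exactly those of type B and
  the pair can be rebuilt.\<close>

lemma reduced_pair_structure:
  assumes "1 < n" and red: "reduced_pair n A B"
  defines "S \<equiv> cuts n A B" and "Q \<equiv> occupied n A B"
  shows "block_structure n S Q" "up_closed (next_in n S) Q (A \<inter> S)"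
    "A = left_set n S (A \<inter> S)" "B = right_set n S (Q - A \<inter> S)"
proof -
  define U where "U = A \<inter> S"
  have AB: "A \<subset> {..<n}" "B \<subset> {..<n}"
    using red by (auto simp: reduced_pair_def)
  have S: "S \<subseteq> {..<n}"
    by (auto simp: S_def cuts_def)
  let ?\<sigma> = "next_in n S"
  let ?\<tau> = "inv ?\<sigma>"
  have \<sigma>\<tau>: "?\<sigma> (?\<tau> x) = x" "?\<tau> (?\<sigma> x) = x" for x
    using bij_next_in[OF S] by (simp_all add: bij_is_surj surj_f_inv_f bij_is_inj inv_f_f)
  have block: "Suc (?\<tau> e) mod n \<notin> B" if "e \<in> S" "e \<in> A" for e
    using reduced_pair_block[OF \<open>1 < n\<close> red] that by (simp add: S_def)
  have cut: "Suc e mod n \<notin> B" if "e \<in> S" "e \<in> A" for e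
    using that by (simp add: S_def cuts_def)
  have glued: "x \<in> A" "Suc x mod n \<in> B" if "x < n" "x \<notin> S" for x
    using that by (auto simp: S_def cuts_def)
  have Q: "e \<in> Q \<longleftrightarrow> e \<in> S \<and> (e \<in> A \<or> Suc (?\<tau> e) mod n \<in> B)" for e
    by (auto simp: Q_def occupied_def S_def)
  have up: "up_closed ?\<sigma> Q U"
    unfolding up_closed_def
  proof (intro conjI ballI impI)
    show "U \<subseteq> Q"
      using Q by (auto simp: U_def)
    fix e assume "e \<in> U" "?\<sigma> e \<in> Q"
    then have "Suc e mod n \<notin> B"
      using cut by (simp add: U_def)
    then show "?\<sigma> e \<in> U"
      using Q[of "?\<sigma> e"] \<open>?\<sigma> e \<in> Q\<close> \<sigma>\<tau>(2)[of e] by (simp add: U_def)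
  qed
  obtain z where z: "z < n" "z \<notin> A"
    using AB by auto
  then have "z \<in> S"
    by (simp add: S_def cuts_def)
  obtain y where y: "y < n" "y \<notin> B"
    using AB by auto
  then have "y \<in> (\<lambda>x. Suc x mod n) ` {..<n}"
    by (simp add: Suc_mod_image)
  then obtain y' where y': "y' < n" "Suc y' mod n = y"
    by auto
  then have "y' \<in> S"
    using y(2) glued(2)[of y'] by blast
  \<comment> \<open>If every block were occupied, the one starting at \<open>y\<close>, which is
    missing from \<open>B\<close>, would have type A. Closure would spread type A around the circle
    and put \<open>z\<close> into \<open>A\<close>.\<close>
  have "Q \<noteq> S"
  proof
    assume "Q = S"
    have occ: "?\<sigma> y' \<in> Q"
      using \<open>Q = S\<close> next_in_closed[OF S \<open>y' \<in> S\<close>] by simp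
    then have "?\<sigma> y' \<in> U"
      using Q[of "?\<sigma> y'"] y(2) y'(2) \<sigma>\<tau>(2)[of y'] by (simp add: U_def)
    then have reach: "(?\<sigma> ^^ j) (?\<sigma> y') \<in> U" for j
    proof (induction j)
      case (Suc j)
      then have "(?\<sigma> ^^ Suc j) (?\<sigma> y') \<in> S"
        using next_in_closed[OF S] by (simp add: U_def)
      then show ?case
        using Suc up \<open>Q = S\<close> by (simp add: up_closed_def)
    qed simp
    obtain k where "(?\<sigma> ^^ k) (?\<sigma> y') = z"
      by (rule next_in_transitive[OF S next_in_closed[OF S \<open>y' \<in> S\<close>] \<open>z \<in> S\<close>])
    then show False
      using reach[of k] z by (simp add: U_def)
  qed
  moreover have "Q \<subseteq> S"
    using Q by blast
  ultimately interpret block_structure n S Q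
    using \<open>1 < n\<close> S by unfold_locales auto
  show "block_structure n S Q"
    by (rule block_structure_axioms)
  show "up_closed ?\<sigma> Q (A \<inter> S)"
    using up by (simp add: U_def)
  show "A = left_set n S (A \<inter> S)"
    using AB glued(1) by (auto simp: left_set_def)
  have "Suc x mod n \<in> B \<longleftrightarrow> Suc x mod n \<in> right_set n S (Q - U)" if "x < n" for x
  proof (cases "x \<in> S")
    case True
    then have "?\<sigma> x \<in> S"
      by (rule next_in_closed[OF S])
    then have "Suc x mod n \<in> B \<longleftrightarrow> ?\<sigma> x \<in> Q - U"
      using Q[of "?\<sigma> x"] block[of "?\<sigma> x"] \<sigma>\<tau>(2)[of x] unfolding U_def by auto
    then show ?thesis
      using Suc_in_right_set_iff[OF Diff_subset that] True by simp
  next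
    case False
    then show ?thesis
      using Suc_in_right_set_iff[OF Diff_subset that] glued(2)[OF that] by simp
  qed
  moreover have "right_set n S (Q - U) \<subseteq> {..<n}"
    using right_set_psubset[OF Diff_subset] by blast
  moreover have "\<exists>x<n. y = Suc x mod n" if "y < n" for y
    using that Suc_mod_image[of n] by (auto simp: set_eq_iff image_iff)
  moreover have "B \<subseteq> {..<n}"
    using AB by blast
  ultimately have "B = right_set n S (Q - U)"
    by (intro set_eqI) (metis lessThan_iff subsetD)
  then show "B = right_set n S (Q - A \<inter> S)"
    by (simp add: U_def)
qed

text \<open>The choice depends on \<open>S\<close> and \<open>Q\<close> only. These survive the
  swap, so a second swap uses the same function and undoes the first.\<close>

definition reversal :: "nat \<Rightarrow> nat set \<Rightarrow> nat set \<Rightarrow> nat set \<Rightarrow> nat set" where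
  "reversal n S Q = (SOME \<psi>. \<forall>U. up_closed (next_in n S) Q U \<longrightarrow>
     up_closed (next_in n S) Q (\<psi> U) \<and> \<psi> (\<psi> U) = U \<and> card (\<psi> U) = card (Q - U))"

definition swap_pair :: "nat \<Rightarrow> nat set \<Rightarrow> nat set \<Rightarrow> nat set \<times> nat set" where
  "swap_pair n A B =
     (let S = cuts n A B; Q = occupied n A B; U = reversal n S Q (A \<inter> S)
      in (left_set n S U, right_set n S (Q - U)))"

lemma (in block_structure) reversal:
  assumes "up_closed \<sigma> Q U"
  shows "up_closed \<sigma> Q (reversal n S Q U)" "reversal n S Q (reversal n S Q U) = U"
    "card (reversal n S Q U) = card (Q - U)"
proof -
  have "\<exists>\<psi>. \<forall>U. up_closed \<sigma> Q U \<longrightarrow>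
     up_closed \<sigma> Q (\<psi> U) \<and> \<psi> (\<psi> U) = U \<and> card (\<psi> U) = card (Q - U)"
    using \<sigma>_\<tau> \<tau>_\<sigma> exit_Q finite_Q(1) by (rule up_closed_reversal)
  from someI_ex[OF this] assms
  show "up_closed \<sigma> Q (reversal n S Q U)" "reversal n S Q (reversal n S Q U) = U"
    "card (reversal n S Q U) = card (Q - U)"
    by (simp_all add: reversal_def)
qed

text \<open>Both pairs have the same cuts and occupied blocks and hence saturate to the same
  product. Their sizes are the number of letters that are not cuts plus the number of type A,
  respectively type B, blocks; the reversal exchanges these two numbers.\<close>

lemma swap_pair:
  assumes "1 < n" "reduced_pair n A B" "swap_pair n A B = (A', B')"
  shows "reduced_pair n A' B'" "card A' = card B" "card B' = card A"
    "aff_eq n (cyc_word n A @ cyc_word n B) (cyc_word n A' @ cyc_word n B')"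
    "swap_pair n A' B' = (A, B)"
proof -
  define S Q U where "S = cuts n A B" and "Q = occupied n A B" and "U = A \<inter> S"
  define U' where "U' = reversal n S Q U"
  interpret block_structure n S Q
    using reduced_pair_structure(1)[OF assms(1,2)] by (simp add: S_def Q_def)
  have up: "up_closed \<sigma> Q U"
    using reduced_pair_structure(2)[OF assms(1,2)] by (simp add: S_def Q_def U_def)
  have AB: "A = left_set n S U" "B = right_set n S (Q - U)"
    using reduced_pair_structure(3,4)[OF assms(1,2)] by (simp_all add: S_def Q_def U_def)
  have up': "up_closed \<sigma> Q U'" and "reversal n S Q U' = U" and card: "card U' = card (Q - U)"
    using reversal[OF up] by (simp_all add: U'_def)
  have sub: "U \<subseteq> Q" "U' \<subseteq> Q"
    using up up' by (simp_all add: up_closed_def)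
  have A'B': "A' = left_set n S U'" "B' = right_set n S (Q - U')"
    using assms(3) by (simp_all add: swap_pair_def Let_def S_def Q_def U_def U'_def)
  have "card (Q - U') = card U"
    using reversal(3)[OF up'] \<open>reversal n S Q U' = U\<close> by simp
  then show cards: "card A' = card B" "card B' = card A"
    using card sub by (simp_all add: AB A'B' card_left_set card_right_set)
  show eq: "aff_eq n (cyc_word n A @ cyc_word n B) (cyc_word n A' @ cyc_word n B')"
    using aff_eq_saturate[OF up] aff_eq_saturate[OF up'] unfolding AB A'B'
    by (blast intro: aff_eq_trans aff_eq_sym)
  show "reduced_pair n A' B'"
    using assms(2) cards aff_len_cong[OF eq] left_set_psubset[OF sub(2)]
      right_set_psubset[OF Diff_subset] by (simp add: reduced_pair_def A'B')
  have "cuts n A' B' = S" "occupied n A' B' = Q" "A' \<inter> S = U'"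
    using cuts_eq[OF up'] occupied_eq[OF up'] left_set_Int_cuts[OF sub(2)] by (simp_all add: A'B')
  then show "swap_pair n A' B' = (A, B)"
    using \<open>reversal n S Q U' = U\<close> by (simp add: swap_pair_def AB)
qed

subsection \<open>Symmetry of the coefficients\<close>

definition factor_word :: "nat \<Rightarrow> (nat \<Rightarrow> nat set) \<Rightarrow> nat list \<Rightarrow> nat list" where
  "factor_word n A is = concat (map (\<lambda>i. cyc_word n (A i)) is)"

text \<open>Supports replace classes here. The length condition makes the concatenated word
  reduced.\<close>

definition factorizations :: "nat \<Rightarrow> nat list \<Rightarrow> (nat \<Rightarrow> nat) \<Rightarrow> (nat \<Rightarrow> nat set) set" where
  "factorizations n w a = {A. (\<forall>i. A i \<subset> {..<n} \<and> card (A i) = a i) \<and>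
     (\<exists>N. (\<forall>i\<ge>N. a i = 0) \<and> aff_eq n (factor_word n A [0..<N]) w \<and>
          length (factor_word n A [0..<N]) = aff_len n w)}"

lemma length_factor_word:
  assumes "\<And>i. A i \<subset> {..<n} \<and> card (A i) = a i"
  shows "length (factor_word n A [0..<N]) = sum a {..<N}"
  using assms by (induction N) (simp_all add: factor_word_def length_cyc_word)

text \<open>Sending supports to classes is injective by \<open>aff_eq_cyc_word_iff\<close>. It
  reaches every counted sequence because a cyclically decreasing word is equivalent to the word
  chosen for its support.\<close>

lemma aff_stanley_coeff_eq:
  assumes "1 < n"
  shows "aff_stanley_coeff n w a = card (factorizations n w a)"
proof -
  let ?F = "\<lambda>A i. aff_class n (cyc_word n (A i))"
  have "inj_on ?F (factorizations n w a)"
  proof (rule inj_onI)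
    fix A B assume A: "A \<in> factorizations n w a" and B: "B \<in> factorizations n w a"
      and eq: "?F A = ?F B"
    show "A = B"
    proof
      fix i
      have "A i \<subset> {..<n}" "B i \<subset> {..<n}"
        using A B by (auto simp: factorizations_def)
      moreover have "aff_eq n (cyc_word n (A i)) (cyc_word n (B i))"
        using fun_cong[OF eq, of i] by (simp add: aff_class_eq_iff)
      ultimately show "A i = B i"
        using aff_eq_cyc_word_iff[OF assms] by blast
    qed
  qed
  moreover have "{V. \<exists>us N.
      (\<forall>i. V i = aff_class n (us i) \<and> cd_elem n (us i) \<and> aff_len n (us i) = a i) \<and>
      (\<forall>i\<ge>N. a i = 0) \<and> aff_eq n (concat (map us [0..<N])) w \<and>
      (\<Sum>i<N. a i) = aff_len n w} = ?F ` factorizations n w a" (is "?L = ?R")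
  proof (intro equalityI subsetI)
    fix V assume "V \<in> ?L"
    then obtain us N where V: "\<And>i. V i = aff_class n (us i)" "\<And>i. cd_elem n (us i)"
      "\<And>i. aff_len n (us i) = a i" and N: "\<forall>i\<ge>N. a i = 0"
      "aff_eq n (concat (map us [0..<N])) w" "(\<Sum>i<N. a i) = aff_len n w"
      by blast
    have "\<forall>i. \<exists>u. aff_eq n (us i) u \<and> cyc_dec_word n u \<and> length u = a i"
      using V(2,3) by (auto simp: cd_elem_def)
    then obtain u where u: "\<And>i. aff_eq n (us i) (u i)" "\<And>i. cyc_dec_word n (u i)"
      "\<And>i. length (u i) = a i"
      by metis
    define A where "A i = set (u i)" for i
    have A: "A i \<subset> {..<n} \<and> card (A i) = a i" for i
      using u(2,3)[of i] cyc_dec_word_set_psubset[OF assms u(2)[of i]] distinct_card[of "u i"]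
      by (simp add: A_def cyc_dec_word_iff)
    have eq: "aff_eq n (cyc_word n (A i)) (us i)" for i
      using aff_eq_cyc_word[OF u(2)[of i] assms] aff_eq_sym[OF u(1)[of i]]
      unfolding A_def by (rule aff_eq_trans)
    have "aff_eq n (factor_word n A [0..<N]) w"
      unfolding factor_word_def using aff_eq_concat[of "[0..<N]", OF eq] N(2) by (rule aff_eq_trans)
    then have "A \<in> factorizations n w a"
      using A N length_factor_word[of A n a N, OF A] unfolding factorizations_def by auto
    moreover have "V = ?F A"
      using eq by (intro ext) (simp only: V(1) aff_class_eq_iff aff_eq_sym)
    ultimately show "V \<in> ?R"
      by blast
  next
    fix V assume "V \<in> ?R"
    then obtain A where V: "V = ?F A" and "A \<in> factorizations n w a"
      by blast
    then obtain N where A: "\<And>i. A i \<subset> {..<n} \<and> card (A i) = a i" and N: "\<forall>i\<ge>N. a i = 0"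
      "aff_eq n (factor_word n A [0..<N]) w" "length (factor_word n A [0..<N]) = aff_len n w"
      by (auto simp: factorizations_def)
    have "cd_elem n (cyc_word n (A i))" "aff_len n (cyc_word n (A i)) = a i" for i
    proof -
      have Ai: "A i \<subset> {..<n}" "card (A i) = a i"
        using A by simp_all
      show "aff_len n (cyc_word n (A i)) = a i"
        using aff_len_cyc_word[OF assms Ai(1)] Ai(2) by simp
      then show "cd_elem n (cyc_word n (A i))"
        using cyc_word[OF Ai(1)] length_cyc_word[OF Ai(1)] Ai
        unfolding cd_elem_def by (intro conjI exI[of _ "cyc_word n (A i)"]) auto
    qed
    then show "V \<in> ?L"
      using N length_factor_word[of A n a N, OF A] V unfolding factor_word_def
      by (intro CollectI exI[of _ "\<lambda>i. cyc_word n (A i)"] exI[of _ N]) simp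
  qed
  ultimately show ?thesis
    unfolding aff_stanley_coeff_def by (simp add: card_image)
qed

lemma factor_word_extend:
  assumes "\<And>i. A i \<subset> {..<n} \<and> card (A i) = a i" "\<forall>i\<ge>N. a i = 0" "N \<le> M"
  shows "factor_word n A [0..<M] = factor_word n A [0..<N]"
proof -
  have "cyc_word n (A i) = []" if "N \<le> i" for i
    using length_cyc_word[of "A i" n] assms(1)[of i] assms(2) that by simp
  then have "factor_word n A [N..<M] = []"
    by (simp add: factor_word_def)
  moreover have "[0..<M] = [0..<N] @ [N..<M]"
    using assms(3) upt_add_eq_append[of 0 N "M - N"] by simp
  ultimately show ?thesis
    by (simp add: factor_word_def)
qed

lemma factor_word_split:
  "factor_word n A [0..<Suc (Suc (i + k))] =
     factor_word n A [0..<i] @ (cyc_word n (A i) @ cyc_word n (A (Suc i))) @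
     factor_word n A [Suc (Suc i)..<Suc (Suc (i + k))]"
proof -
  have "[0..<Suc (Suc (i + k))] = [0..<i] @ [i..<i + Suc (Suc k)]"
    using upt_add_eq_append[of 0 i "Suc (Suc k)"] by simp
  also have "[i..<i + Suc (Suc k)] = i # Suc i # [Suc (Suc i)..<Suc (Suc (i + k))]"
    by (simp add: upt_conv_Cons del: upt_Suc)
  finally show ?thesis
    by (simp add: factor_word_def del: upt_Suc)
qed

definition swap_factors :: "nat \<Rightarrow> nat \<Rightarrow> (nat \<Rightarrow> nat set) \<Rightarrow> nat \<Rightarrow> nat set" where
  "swap_factors n i A = A(i := fst (swap_pair n (A i) (A (Suc i))),
     Suc i := snd (swap_pair n (A i) (A (Suc i))))"

text \<open>Two neighbouring factors form a subword of a reduced word, hence a reduced pair, to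
  which \<open>swap_pair\<close> applies.\<close>

lemma swap_factors:
  assumes "1 < n" and A: "A \<in> factorizations n w a"
  shows "swap_factors n i A \<in> factorizations n w (a(i := a (Suc i), Suc i := a i))"
    "swap_factors n i (swap_factors n i A) = A"
proof -
  obtain N where a: "\<And>j. A j \<subset> {..<n} \<and> card (A j) = a j" and N: "\<forall>j\<ge>N. a j = 0"
    "aff_eq n (factor_word n A [0..<N]) w" "length (factor_word n A [0..<N]) = aff_len n w"
    using A by (auto simp: factorizations_def)
  \<comment> \<open>Large enough to include both swapped positions and all nontrivial factors; the
    trivial ones contribute empty words.\<close>
  define M where "M = Suc (Suc (i + N))"
  let ?P = "factor_word n A [0..<i]" and ?R = "factor_word n A [Suc (Suc i)..<M]"
  let ?m = "cyc_word n (A i) @ cyc_word n (A (Suc i))"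
  have split: "factor_word n A [0..<N] = ?P @ ?m @ ?R"
    using factor_word_extend[of A n a N M, OF a N(1)] factor_word_split[of n A i N]
    by (simp add: M_def del: upt_Suc)
  have red: "reduced_pair n (A i) (A (Suc i))"
  proof -
    obtain v where v: "aff_eq n ?m v" "length v = aff_len n ?m"
      by (rule aff_len_attained)
    have "aff_eq n w (?P @ ?m @ ?R)"
      using N(2) split by (simp add: aff_eq_sym)
    also have "aff_eq n (?P @ ?m @ ?R) (?P @ v @ ?R)"
      using v(1) by (rule aff_eq_context)
    finally have "aff_len n w \<le> length (?P @ v @ ?R)"
      by (rule aff_len_le)
    then have "length ?m \<le> aff_len n ?m"
      using N(3) split v(2) by simp
    moreover have "aff_len n ?m \<le> length ?m"
      by (rule aff_len_le) simp
    ultimately have "aff_len n ?m = length ?m"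
      by simp
    then show ?thesis
      using a length_cyc_word[of "A i" n] length_cyc_word[of "A (Suc i)" n]
      by (simp add: reduced_pair_def)
  qed
  obtain X Y where XY: "swap_pair n (A i) (A (Suc i)) = (X, Y)"
    by (cases "swap_pair n (A i) (A (Suc i))")
  note swap = swap_pair[OF assms(1) red XY]
  let ?A = "swap_factors n i A" and ?a = "a(i := a (Suc i), Suc i := a i)"
  have A': "?A = A(i := X, Suc i := Y)"
    by (simp add: swap_factors_def XY)
  show "swap_factors n i ?A = A"
    using swap(5) unfolding A' by (simp add: swap_factors_def fun_eq_iff)
  have "X \<subset> {..<n}" "Y \<subset> {..<n}"
    using swap(1) by (simp_all add: reduced_pair_def)
  then have a': "?A j \<subset> {..<n} \<and> card (?A j) = ?a j" for j
    using a swap(2,3) by (simp add: A')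
  have "?P = factor_word n ?A [0..<i]" "?R = factor_word n ?A [Suc (Suc i)..<M]"
    unfolding factor_word_def by (auto simp: A' intro!: arg_cong[where f = concat])
  then have split': "factor_word n ?A [0..<M] = ?P @ (cyc_word n X @ cyc_word n Y) @ ?R"
    using factor_word_split[of n ?A i N] by (simp add: M_def A' del: upt_Suc)
  have "aff_eq n (factor_word n ?A [0..<M]) (factor_word n A [0..<N])"
    unfolding split split' using aff_eq_sym[OF swap(4)] by (rule aff_eq_context)
  then have "aff_eq n (factor_word n ?A [0..<M]) w"
    using N(2) by (rule aff_eq_trans)
  moreover have "length (factor_word n ?A [0..<M]) = aff_len n w"
    unfolding N(3)[symmetric] split split' using a swap(2,3) \<open>X \<subset> {..<n}\<close> \<open>Y \<subset> {..<n}\<close>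
    by (simp add: length_cyc_word)
  moreover have "\<forall>j\<ge>M. ?a j = 0"
    using N(1) by (simp add: M_def)
  ultimately show "?A \<in> factorizations n w ?a"
    using a' unfolding factorizations_def by blast
qed

lemma card_factorizations_swap:
  assumes "1 < n"
  shows "card (factorizations n w (a(i := a (Suc i), Suc i := a i))) = card (factorizations n w a)"
proof -
  let ?a = "a(i := a (Suc i), Suc i := a i)"
  have "?a(i := ?a (Suc i), Suc i := ?a i) = a"
    by auto
  then have "bij_betw (swap_factors n i) (factorizations n w ?a) (factorizations n w a)"
    using swap_factors[OF assms, of _ w ?a i] swap_factors[OF assms, of _ w a i]
    by (intro bij_betw_byWitness[where f' = "swap_factors n i"]) auto
  then show ?thesis
    by (rule bij_betw_same_card)
qed

section \<open>From adjacent swaps to arbitrary permutations\<close>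

lemma invariant_under_adjacent_swaps:
  assumes "\<And>u x y v. g (u @ x # y # v) = g (u @ y # x # v)" "mset xs = mset ys"
  shows "g xs = g ys"
  using assms
proof (induction xs arbitrary: ys g)
  case Nil
  then show ?case by simp
next
  case (Cons x xs)
  have "x \<in> set ys"
    using mset_eq_setD[OF Cons.prems(2)] by auto
  then obtain p q where ys: "ys = p @ x # q"
    by (meson split_list)
  \<comment> \<open>Adjacent swaps carry \<open>x\<close> to the left across \<open>p\<close>. The
    prefix \<open>u\<close> is arbitrary because the induction moves letters of \<open>p\<close>
    into it.\<close>
  have "g (u @ p @ x # q) = g (u @ x # p @ q)" for u
  proof (induction p arbitrary: u)
    case (Cons y p)
    have "g (u @ (y # p) @ x # q) = g ((u @ [y]) @ p @ x # q)"
      by simp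
    also have "\<dots> = g ((u @ [y]) @ x # p @ q)"
      by (rule Cons.IH)
    also have "\<dots> = g (u @ x # y # p @ q)"
      using Cons.prems \<open>\<And>u x y v. g (u @ x # y # v) = g (u @ y # x # v)\<close> by simp
    finally show ?case by simp
  qed simp
  from this[of "[]"] have "g ys = g (x # p @ q)"
    by (simp add: ys)
  moreover have "g (x # xs) = g (x # (p @ q))"
  \<comment> \<open>With \<open>x\<close> fixed in front, \<open>g\<close> is again invariant under
    adjacent swaps.\<close>
  proof (rule Cons.IH[of "\<lambda>zs. g (x # zs)"])
    show "g (x # u @ y # z # v) = g (x # u @ z # y # v)" for u y z v
      using Cons.prems(1)[of "x # u" y z v] by simp
    show "mset xs = mset (p @ q)"
      using Cons.prems(2) by (simp add: ys)
  qed
  ultimately show ?case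
    by simp
qed

text \<open>Outside the support only zeros are added, so the multiset of values depends on
  \<open>M\<close> only through its size.\<close>

lemma image_mset_eq_support:
  fixes a :: "'a \<Rightarrow> nat"
  assumes "finite M" "{i. a i \<noteq> 0} \<subseteq> M"
  shows "image_mset a (mset_set M) =
    image_mset a (mset_set {i. a i \<noteq> 0}) + replicate_mset (card M - card {i. a i \<noteq> 0}) 0"
proof -
  let ?s = "{i. a i \<noteq> 0}"
  have "finite ?s"
    using assms by (rule rev_finite_subset)
  then have "mset_set M = mset_set ?s + mset_set (M - ?s)"
    using assms mset_set_Union[of ?s "M - ?s"] by (simp add: Un_absorb1)
  moreover have "image_mset a (mset_set (M - ?s)) = image_mset (\<lambda>_. 0) (mset_set (M - ?s))"
    using assms(1) by (intro image_mset_cong) simp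
  ultimately show ?thesis
    using assms \<open>finite ?s\<close> by (simp add: image_mset_const_eq card_Diff_subset)
qed

lemma permutation_invariant_if_swap_invariant:
  fixes c :: "(nat \<Rightarrow> nat) \<Rightarrow> 'b"
  assumes swap: "\<And>a i. c (a(i := a (Suc i), Suc i := a i)) = c a"
    and a: "finite {i. a i \<noteq> 0}" and \<sigma>: "bij \<sigma>"
  shows "c (a \<circ> \<sigma>) = c a"
proof -
  \<comment> \<open>Lists encode finitely supported exponent vectors, padded with zeros.\<close>
  define g where "g xs = c (\<lambda>i. if i < length xs then xs ! i else 0)" for xs
  have g_swap: "g (u @ x # y # v) = g (u @ y # x # v)" for u x y v
  proof -
    let ?b = "\<lambda>i. if i < length (u @ y # x # v) then (u @ y # x # v) ! i else 0"
    have "(\<lambda>i. if i < length (u @ x # y # v) then (u @ x # y # v) ! i else 0)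
        = ?b(length u := ?b (Suc (length u)), Suc (length u) := ?b (length u))"
      by (auto simp: fun_eq_iff nth_append nth_Cons split: nat.splits)
    then show ?thesis
      unfolding g_def using swap[of ?b "length u"] by simp
  qed
  have supp: "{i. (a \<circ> \<sigma>) i \<noteq> 0} = inv \<sigma> ` {i. a i \<noteq> 0}"
    using \<sigma> by (auto simp: bij_is_inj bij_is_surj surj_f_inv_f intro!: image_eqI[of _ "inv \<sigma>"])
  then have "finite ({i. a i \<noteq> 0} \<union> {i. (a \<circ> \<sigma>) i \<noteq> 0})"
    using a by simp
  then obtain N where N: "{i. a i \<noteq> 0} \<union> {i. (a \<circ> \<sigma>) i \<noteq> 0} \<subseteq> {..<N}"
    using finite_nat_set_iff_bounded by (auto simp only: lessThan_iff subset_eq)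
  have g_eq: "c b = g (map b [0..<N])" if "{i. b i \<noteq> 0} \<subseteq> {..<N}" for b
  proof -
    have "b = (\<lambda>i. if i < length (map b [0..<N]) then map b [0..<N] ! i else 0)"
      using that by (fastforce simp: fun_eq_iff)
    then show ?thesis
      by (simp add: g_def)
  qed
  \<comment> \<open>The permutation need not preserve the first \<open>N\<close> indices, but their
    image still contains the support and has the same size; hence the multisets of values
    agree.\<close>
  have "\<sigma> ` {..<N} \<supseteq> {i. a i \<noteq> 0}"
  proof
    fix i assume i: "i \<in> {i. a i \<noteq> 0}"
    have \<sigma>_inv: "\<sigma> (inv \<sigma> i) = i"
      using \<sigma> by (simp add: bij_is_surj surj_f_inv_f)
    with i have "inv \<sigma> i \<in> {..<N}"
      by (intro subsetD[OF N]) simp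
    then show "i \<in> \<sigma> ` {..<N}"
      by (rule image_eqI[rotated]) (simp add: \<sigma>_inv)
  qed
  moreover have "card (\<sigma> ` {..<N}) = card {..<N}"
    using \<sigma> by (meson bij_is_inj card_image inj_on_subset subset_UNIV)
  ultimately have "image_mset a (mset_set (\<sigma> ` {..<N})) = image_mset a (mset_set {..<N})"
    using image_mset_eq_support[of "\<sigma> ` {..<N}" a] image_mset_eq_support[of "{..<N}" a] N by simp
  moreover have "mset_set (\<sigma> ` {..<N}) = image_mset \<sigma> (mset_set {..<N})"
    using \<sigma> by (metis bij_is_inj image_mset_mset_set inj_on_subset subset_UNIV)
  ultimately have "mset (map (a \<circ> \<sigma>) [0..<N]) = mset (map a [0..<N])"
    by (simp add: image_mset.compositionality lessThan_atLeast0)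
  with g_swap have "g (map (a \<circ> \<sigma>) [0..<N]) = g (map a [0..<N])"
    by (rule invariant_under_adjacent_swaps)
  then show ?thesis
    using g_eq[of a] g_eq[of "a \<circ> \<sigma>"] N by simp
qed

theorem theorem3p2:
  fixes n :: nat and w :: "nat list"
  assumes "n > 2" and "set w \<subseteq> {..<n}"
  shows "symmetric_function (aff_stanley_coeff n w)"
proof -
  have n: "1 < n"
    using assms by simp
  \<comment> \<open>A nonzero coefficient yields a factorization, whose factors have total length
    \<open>aff_len n w\<close>; this bounds the degree.\<close>
  have support: "finite {i. a i \<noteq> 0} \<and> sum a {i. a i \<noteq> 0} \<le> aff_len n w"
    if "aff_stanley_coeff n w a \<noteq> 0" for a
  proof -
    have "factorizations n w a \<noteq> {}"
      using that by (auto simp: aff_stanley_coeff_eq[OF n])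
    then obtain A where "A \<in> factorizations n w a"
      by blast
    then obtain N where A: "\<And>i. A i \<subset> {..<n} \<and> card (A i) = a i" and N: "\<forall>i\<ge>N. a i = 0"
      "length (factor_word n A [0..<N]) = aff_len n w"
      by (auto simp: factorizations_def)
    have sub: "{i. a i \<noteq> 0} \<subseteq> {..<N}"
      using N(1) by (auto intro: ccontr)
    then show ?thesis
      using sum_mono2[OF _ sub, of a] length_factor_word[of A n a N, OF A] N(2)
      by (auto intro: finite_subset)
  qed
  have "aff_stanley_coeff n w (a \<circ> \<sigma>) = aff_stanley_coeff n w a" if \<sigma>: "bij \<sigma>" for a \<sigma>
  proof (cases "finite {i. a i \<noteq> 0}")
    case True
    then show ?thesis
      using \<sigma> by (intro permutation_invariant_if_swap_invariant)
        (simp_all only: aff_stanley_coeff_eq[OF n] card_factorizations_swap[OF n])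
  next
    \<comment> \<open>Permuting the variables keeps the support infinite, so both coefficients
      vanish by \<open>support\<close>.\<close>
    case False
    have "{i. a i \<noteq> 0} = \<sigma> ` {i. (a \<circ> \<sigma>) i \<noteq> 0}"
      using \<sigma> by (auto simp: bij_is_surj surj_f_inv_f image_iff intro!: exI[of _ "inv \<sigma> _"])
    then have "infinite {i. (a \<circ> \<sigma>) i \<noteq> 0}"
      using False by (metis finite_imageI)
    then show ?thesis
      using False support by metis
  qed
  then show ?thesis
    using support unfolding symmetric_function_def by blast
qed

end
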